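(* Let $a=(a_i)_{i\in\mathbb Z}$ be a sequence of pairwise distinct complex numbers and $\mu$ a Young diagram. An element $F\in\Lambda$ equals $s_{\mu;a}$ if and only if (i) $F(x(\lambda);y(\lambda))=0$ for all Young diagrams $\lambda\ne\mu$ with $|\lambda|\le|\mu|$, and (ii) $F$ has degree $\le|\mu|$ and $F(x(\mu);y(\mu))=\prod_{(i,j)\in\mu}(a_{\mu_i-i+1}-a_{j-\mu'_j})$. Also, $F$ equals $s_{\mu;a}$ if and only if (i$'$) $F(x(\lambda);y(\lambda))=0$ for all Young diagrams $\lambda$ with $|\lambda|<|\mu|$, and (ii$'$) the top-degree homogeneous component of $F$ is the Schur function $s_\mu$.
   Context: $\Lambda$ is the algebra of symmetric functions over $\mathbb C$ with complete homogeneous $h_k$, elementary $e_k$, power sums $\mathbf p_k$, Schur functions $s_\mu$. For a sequence $a$ define $h_{k;a}=\sum_{i=1}^k(-1)^{k-i}e_{k-i}(a_1,\dots,a_{k-1})h_i$ ($k\ge1$), $h_{0;a}=1$, $h_{k;a}=0$ ($k<0$); $(\tau^ra)_i=a_{i+r}$; $s_{\mu;a}=\det[h_{\mu_i-i+j;\,\tau^{1-j}a}]_{i,j=1}^N$ for any $N\ge\ell(\mu)$. Dual sequence: $\widehat a_i=-a_{1-i}$. $\mu'$ is the transposed diagram; boxes $(i,j)$ are indexed by row $i$ and column $j$. Each $f\in\Lambda$ is evaluated at $(x;y)\in\mathbb C^d\times\mathbb C^d$ via $\mathbf p_k\mapsto\sum_ix_i^k+(-1)^{k-1}\sum_jy_j^k$.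 For a nonempty diagram $\lambda=(p_1,\dots,p_d\mid q_1,\dots,q_d)$ in Frobenius notation ($p_i=\lambda_i-i$, $q_i=\lambda'_i-i$, $d$ the number of diagonal boxes), $(x(\lambda);y(\lambda))=(a_{p_1+1},\dots,a_{p_d+1};\widehat a_{q_1+1},\dots,\widehat a_{q_d+1})$; and $(x(\varnothing);y(\varnothing))=(0;0)$. *)

theory Defs
  imports "HOL-Analysis.Analysis" "HOL-Library.Poly_Mapping"
begin

(* The ring Lambda of symmetric functions over C, modelled as the polynomial
   ring C[p_1, p_2, ...] in the power sums (which are algebraically independent
   and generate Lambda over C).  A monomial m :: nat =>0 nat records
   multiplicities: Poly_Mapping.lookup m i = multiplicity of p_(i+1). *)
type_synonym symfun = "(nat \<Rightarrow>\<^sub>0 nat) \<Rightarrow>\<^sub>0 complex"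

definition lconst :: "complex \<Rightarrow> symfun" where
  "lconst c = Poly_Mapping.single 0 c"

(* power sum p_k, k >= 1 *)
definition psum :: "nat \<Rightarrow> symfun" where
  "psum k = Poly_Mapping.single (Poly_Mapping.single (k - 1) 1) 1"

definition mweight :: "(nat \<Rightarrow>\<^sub>0 nat) \<Rightarrow> nat" where
  "mweight m = (\<Sum>i\<in>Poly_Mapping.keys m. (i + 1) * Poly_Mapping.lookup m i)"

definition zee :: "(nat \<Rightarrow>\<^sub>0 nat) \<Rightarrow> complex" where
  "zee m = (\<Prod>i\<in>Poly_Mapping.keys m. of_nat (i + 1) ^ Poly_Mapping.lookup m i * of_nat (fact (Poly_Mapping.lookup m i)))"

(* complete homogeneous symmetric function h_k = sum_{|nu|=k} p_nu / z_nu *)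
definition hcomp :: "nat \<Rightarrow> symfun" where
  "hcomp k = (\<Sum>m\<in>{m. mweight m = k}. Poly_Mapping.single m (1 / zee m))"

(* degree of F (0 for F = 0) *)
definition sdeg :: "symfun \<Rightarrow> nat" where
  "sdeg F = Max (insert 0 (mweight ` Poly_Mapping.keys F))"

definition top_comp :: "symfun \<Rightarrow> symfun" where
  "top_comp F = (\<Sum>m\<in>Poly_Mapping.keys F. if mweight m = sdeg F then Poly_Mapping.single m (Poly_Mapping.lookup F m) else 0)"

definition esym :: "nat \<Rightarrow> nat set \<Rightarrow> (nat \<Rightarrow> complex) \<Rightarrow> complex" where
  "esym r A f = (\<Sum>S\<in>{S. S \<subseteq> A \<and> card S = r}. \<Prod>i\<in>S. f i)"

definition hfac :: "int \<Rightarrow> (int \<Rightarrow> complex) \<Rightarrow> symfun" where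
  "hfac k a = (if k < 0 then 0 else if k = 0 then 1 else
     (\<Sum>i\<in>{1..nat k}. lconst ((-1) ^ (nat k - i) * esym (nat k - i) {1..nat k - 1} (\<lambda>l. a (int l)))
        * hcomp i))"

definition shiftseq :: "int \<Rightarrow> (int \<Rightarrow> complex) \<Rightarrow> int \<Rightarrow> complex" where
  "shiftseq r a = (\<lambda>i. a (i + r))"

definition ldet :: "nat \<Rightarrow> (nat \<Rightarrow> nat \<Rightarrow> 'a::comm_ring_1) \<Rightarrow> 'a" where
  "ldet N M = (\<Sum>\<sigma>\<in>{\<sigma>. \<sigma> permutes {..<N}}. of_int (sign \<sigma>) * (\<Prod>i<N. M i (\<sigma> i)))"

definition is_partition :: "nat list \<Rightarrow> bool" where
  "is_partition mu \<longleftrightarrow> sorted_wrt (\<ge>) mu \<and> 0 \<notin> set mu"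

definition part :: "nat list \<Rightarrow> nat \<Rightarrow> nat" where
  "part mu i = (if 1 \<le> i \<and> i \<le> length mu then mu ! (i - 1) else 0)"

definition conjpart :: "nat list \<Rightarrow> nat \<Rightarrow> nat" where
  "conjpart mu j = card {i\<in>{1..length mu}. j \<le> part mu i}"

definition psize :: "nat list \<Rightarrow> nat" where
  "psize mu = sum_list mu"

definition fschur :: "nat list \<Rightarrow> (int \<Rightarrow> complex) \<Rightarrow> symfun" where
  "fschur mu a = ldet (length mu)
     (\<lambda>i j. hfac (int (part mu (i + 1)) - int (i + 1) + int (j + 1)) (shiftseq (1 - int (j + 1)) a))"

(* ordinary Schur function s_mu (Jacobi-Trudi) *)
definition schur :: "nat list \<Rightarrow> symfun" where
  "schur mu = ldet (length mu)
     (\<lambda>i j. (let k = int (part mu (i + 1)) - int (i + 1) + int (j + 1) in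
              if k < 0 then 0 else hcomp (nat k)))"

definition frob_d :: "nat list \<Rightarrow> nat" where
  "frob_d lam = card {i\<in>{1..length lam}. i \<le> part lam i}"

definition xpt :: "nat list \<Rightarrow> (int \<Rightarrow> complex) \<Rightarrow> complex list" where
  "xpt lam a = map (\<lambda>i. a (int (part lam i) - int i + 1)) [1..<frob_d lam + 1]"

(* y(lambda) = (ahat_{q_1+1},...), ahat_i = - a_{1-i}, q_i = lambda'_i - i *)
definition ypt :: "nat list \<Rightarrow> (int \<Rightarrow> complex) \<Rightarrow> complex list" where
  "ypt lam a = map (\<lambda>i. - a (1 - (int (conjpart lam i) - int i + 1))) [1..<frob_d lam + 1]"

definition peval :: "nat \<Rightarrow> complex list \<Rightarrow> complex list \<Rightarrow> complex" where
  "peval k xs ys = (\<Sum>x\<leftarrow>xs. x ^ k) + (-1) ^ (k - 1) * (\<Sum>y\<leftarrow>ys. y ^ k)"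

definition seval :: "symfun \<Rightarrow> complex list \<Rightarrow> complex list \<Rightarrow> complex" where
  "seval F xs ys = (\<Sum>m\<in>Poly_Mapping.keys F. Poly_Mapping.lookup F m * (\<Prod>i\<in>Poly_Mapping.keys m. peval (i + 1) xs ys ^ Poly_Mapping.lookup m i))"

definition eval_at :: "symfun \<Rightarrow> nat list \<Rightarrow> (int \<Rightarrow> complex) \<Rightarrow> complex" where
  "eval_at F lam a = seval F (xpt lam a) (ypt lam a)"

end

theory Submission
  imports Defs "Jordan_Normal_Form.Determinant"
begin

text \<open>At the point of \<open>\<lambda>\<close>, with \<open>N \<ge> \<ell>(\<lambda>)\<close>, the generating function of the \<open>h\<^sub>k\<close> is the product of
  \<open>(1 - a\<^bsub>1-i\<^esub> t) / (1 - x\<^sub>i t)\<close> over \<open>1 \<le> i \<le> N\<close>, where \<open>x\<^sub>i = a\<^bsub>\<lambda>\<^sub>i-i+1\<^esub>\<close>. By partial fractions the entries of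
  the determinant defining \<open>s\<^bsub>\<mu>;a\<^esub>\<close> become divided differences \<open>\<Sum>\<^sub>r f(x\<^sub>r) / \<Prod>\<^bsub>s\<noteq>r\<^esub> (x\<^sub>r - x\<^sub>s)\<close> of explicit
  products of linear factors, so the matrix factors as \<open>A V\<close>, where \<open>A\<^bsub>ir\<^esub> = 0\<close> whenever \<open>\<lambda>\<^sub>r - r < \<mu>\<^sub>i - i\<close>.
  Hence the value vanishes if \<open>|\<lambda>| \<le> |\<mu>|\<close> and \<open>\<lambda> \<noteq> \<mu>\<close>, and for \<open>\<lambda> = \<mu>\<close> it is read off a triangular matrix.
  This triangularity makes the \<open>s\<^bsub>\<mu>;a\<^esub>\<close> with \<open>|\<mu>| < n\<close> linearly independent; since monomials in the power
  sums of weight below \<open>n\<close> are counted by partitions, they span the functions of degree below \<open>n\<close>, and a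
  function of degree below \<open>n\<close> is determined by its values at the points of \<open>\<lambda>\<close> with \<open>|\<lambda>| < n\<close>.
  Both characterisations follow, the second because \<open>s\<^bsub>\<mu>;a\<^esub>\<close> has top component \<open>s\<^sub>\<mu>\<close>.\<close>

hide_const (open) Module.smult

section \<open>Evaluation of symmetric functions\<close>

definition mon_eval :: "(nat \<Rightarrow>\<^sub>0 nat) \<Rightarrow> complex list \<Rightarrow> complex list \<Rightarrow> complex" where
  "mon_eval m xs ys = (\<Prod>i\<in>Poly_Mapping.keys m. peval (i + 1) xs ys ^ Poly_Mapping.lookup m i)"

text \<open>Extending the range to any finite superset of the support lets two operands be compared
  over a common index set; the same device recurs for \<open>seval\<close>, \<open>mweight\<close>
  and \<open>zee\<close>.\<close>

lemma mon_eval_superset: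
  assumes "finite S" "Poly_Mapping.keys m \<subseteq> S"
  shows "mon_eval m xs ys = (\<Prod>i\<in>S. peval (i + 1) xs ys ^ Poly_Mapping.lookup m i)"
  unfolding mon_eval_def
  by (rule prod.mono_neutral_left) (use assms in \<open>auto simp: in_keys_iff\<close>)

lemma mon_eval_0 [simp]: "mon_eval 0 xs ys = 1"
  by (simp add: mon_eval_def)

lemma mon_eval_add: "mon_eval (m + m') xs ys = mon_eval m xs ys * mon_eval m' xs ys"
proof -
  let ?S = "Poly_Mapping.keys m \<union> Poly_Mapping.keys m'"
  have "mon_eval (m + m') xs ys = (\<Prod>i\<in>?S. peval (i + 1) xs ys ^ Poly_Mapping.lookup (m + m') i)"
    by (rule mon_eval_superset) (use Poly_Mapping.keys_add[of m m'] in auto)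
  also have "\<dots> = (\<Prod>i\<in>?S. peval (i + 1) xs ys ^ Poly_Mapping.lookup m i) *
                   (\<Prod>i\<in>?S. peval (i + 1) xs ys ^ Poly_Mapping.lookup m' i)"
    by (simp add: lookup_add power_add prod.distrib)
  also have "\<dots> = mon_eval m xs ys * mon_eval m' xs ys"
    by (simp add: mon_eval_superset[of ?S])
  finally show ?thesis .
qed

lemma seval_superset:
  assumes "finite S" "Poly_Mapping.keys F \<subseteq> S"
  shows "seval F xs ys = (\<Sum>m\<in>S. Poly_Mapping.lookup F m * mon_eval m xs ys)"
  unfolding seval_def mon_eval_def
  by (rule sum.mono_neutral_left) (use assms in \<open>auto simp: in_keys_iff\<close>)

lemma seval_0 [simp]: "seval 0 xs ys = 0"
  by (simp add: seval_def)

lemma seval_single [simp]: "seval (Poly_Mapping.single m c) xs ys = c * mon_eval m xs ys"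
  by (subst seval_superset[of "{m}"]) auto

lemma seval_1 [simp]: "seval 1 xs ys = 1"
  by (metis single_one seval_single mon_eval_0 mult_1)

lemma seval_lconst [simp]: "seval (lconst c) xs ys = c"
  by (simp add: lconst_def)

lemma seval_psum: "k \<ge> 1 \<Longrightarrow> seval (psum k) xs ys = peval k xs ys"
  by (simp add: psum_def mon_eval_def)

lemma seval_add [simp]: "seval (F + G) xs ys = seval F xs ys + seval G xs ys"
proof -
  let ?S = "Poly_Mapping.keys F \<union> Poly_Mapping.keys G"
  have "seval (F + G) xs ys = (\<Sum>m\<in>?S. Poly_Mapping.lookup (F + G) m * mon_eval m xs ys)"
    by (rule seval_superset) (use Poly_Mapping.keys_add[of F G] in auto)
  also have "\<dots> = seval F xs ys + seval G xs ys"
    by (simp add: seval_superset[of ?S] lookup_add algebra_simps sum.distrib)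
  finally show ?thesis .
qed

lemma seval_uminus [simp]: "seval (- F) xs ys = - seval F xs ys"
  using seval_add[of "- F" F xs ys] by (simp add: add_eq_0_iff)

lemma seval_diff [simp]: "seval (F - G) xs ys = seval F xs ys - seval G xs ys"
  using seval_add[of F "- G" xs ys] by simp

lemma seval_sum: "seval (sum f A) xs ys = (\<Sum>x\<in>A. seval (f x) xs ys)"
  by (induction A rule: infinite_finite_induct) auto

lemma symfun_sum_monomials:
  "F = (\<Sum>m\<in>Poly_Mapping.keys F. Poly_Mapping.single m (Poly_Mapping.lookup F m))"
  for F :: "'a \<Rightarrow>\<^sub>0 'b::comm_monoid_add"
proof (rule poly_mapping_eqI)
  fix k
  show "Poly_Mapping.lookup F k = Poly_Mapping.lookup
    (\<Sum>m\<in>Poly_Mapping.keys F. Poly_Mapping.single m (Poly_Mapping.lookup F m)) k"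
    by (simp add: lookup_sum lookup_single when_def in_keys_iff)
qed

lemma seval_mult [simp]: "seval (F * G) xs ys = seval F xs ys * seval G xs ys"
proof -
  have "F * G = (\<Sum>m\<in>Poly_Mapping.keys F. \<Sum>m'\<in>Poly_Mapping.keys G.
      Poly_Mapping.single (m + m') (Poly_Mapping.lookup F m * Poly_Mapping.lookup G m'))"
    by (subst (1) symfun_sum_monomials[of F], subst (1) symfun_sum_monomials[of G])
      (simp add: sum_product mult_single)
  then have "seval (F * G) xs ys = (\<Sum>m\<in>Poly_Mapping.keys F. \<Sum>m'\<in>Poly_Mapping.keys G.
      Poly_Mapping.lookup F m * mon_eval m xs ys * (Poly_Mapping.lookup G m' * mon_eval m' xs ys))"
    by (simp add: seval_sum mon_eval_add mult_ac)
  also have "\<dots> = seval F xs ys * seval G xs ys"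
    by (simp add: sum_product seval_superset[OF finite_keys order.refl])
  finally show ?thesis .
qed

lemma seval_prod: "seval (prod f A) xs ys = (\<Prod>x\<in>A. seval (f x) xs ys)"
  by (induction A rule: infinite_finite_induct) auto

lemma seval_of_nat [simp]: "seval (of_nat n) xs ys = of_nat n"
  by (induction n) auto

lemma seval_of_int [simp]: "seval (of_int n) xs ys = of_int n"
  by (cases n rule: int_cases2) auto

lemma seval_ldet: "seval (ldet N M) xs ys = ldet N (\<lambda>i j. seval (M i j) xs ys)"
  by (simp add: ldet_def seval_sum seval_prod)

section \<open>Partitions as monomials, and Newton's identities\<close>

lemma mweight_superset:
  assumes "finite S" "Poly_Mapping.keys m \<subseteq> S"
  shows "mweight m = (\<Sum>i\<in>S. (i + 1) * Poly_Mapping.lookup m i)"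
  unfolding mweight_def
  by (rule sum.mono_neutral_left) (use assms in \<open>auto simp: in_keys_iff\<close>)

lemma mweight_0 [simp]: "mweight 0 = 0"
  by (simp add: mweight_def)

lemma mweight_add [simp]: "mweight (m + m') = mweight m + mweight m'"
proof -
  let ?S = "Poly_Mapping.keys m \<union> Poly_Mapping.keys m'"
  have "mweight (m + m') = (\<Sum>i\<in>?S. (i + 1) * Poly_Mapping.lookup (m + m') i)"
    by (rule mweight_superset) (use Poly_Mapping.keys_add[of m m'] in auto)
  also have "\<dots> = mweight m + mweight m'"
    by (simp add: mweight_superset[of ?S] lookup_add algebra_simps sum.distrib)
  finally show ?thesis .
qed

lemma mweight_single [simp]: "mweight (Poly_Mapping.single i n) = (i + 1) * n"
  by (simp add: mweight_def)

lemma mweight_eq_0_iff: "mweight m = 0 \<longleftrightarrow> m = 0"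
  by (auto simp: mweight_def in_keys_iff intro!: poly_mapping_eqI)

lemma sum_mset_sum: "\<Sum>\<^sub># (\<Sum>i\<in>A. f i) = (\<Sum>i\<in>A. \<Sum>\<^sub># (f i))"
  by (induction A rule: infinite_finite_induct) auto

text \<open>A monomial in the power sums is a partition written by multiplicities: key
  \<open>i\<close> with exponent c stands for c parts equal to i + 1.\<close>

lemma partition_of_mweight:
  obtains mu where "is_partition mu" "psize mu = mweight m"
    "\<And>i. Poly_Mapping.lookup m i = count (mset mu) (i + 1)"
proof -
  define M where "M = (\<Sum>i\<in>Poly_Mapping.keys m. replicate_mset (Poly_Mapping.lookup m i) (i + 1))"
  define mu where "mu = rev (sorted_list_of_multiset M)"
  have mset_mu: "mset mu = M" by (simp add: mu_def)
  have cnt: "count M (i + 1) = Poly_Mapping.lookup m i" for i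
    unfolding M_def by (simp add: count_sum in_keys_iff)
  have "0 \<notin># M" unfolding M_def by (auto simp: set_mset_sum)
  then have "0 \<notin> set mu" using mset_mu by (metis set_mset_mset)
  moreover have "sorted_wrt (\<ge>) mu"
    unfolding mu_def by (simp add: sorted_wrt_rev)
  moreover have "psize mu = mweight m"
  proof -
    have "psize mu = sum_mset M" unfolding psize_def mset_mu[symmetric] by (simp add: sum_mset_sum_list)
    also have "\<dots> = mweight m"
      unfolding M_def mweight_def by (simp add: sum_mset_sum algebra_simps)
    finally show ?thesis .
  qed
  ultimately show ?thesis using that[of mu] cnt mset_mu by (simp add: is_partition_def)
qed

lemma finite_partitions: "finite {mu. is_partition mu \<and> psize mu < n}"
proof (rule finite_subset)
  show "{mu. is_partition mu \<and> psize mu < n} \<subseteq> {mu. set mu \<subseteq> {..n} \<and> length mu \<le> n}"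
  proof clarify
    fix mu assume "is_partition mu" and n: "psize mu < n"
    then have "0 \<notin> set mu" by (simp add: is_partition_def)
    then have "length mu \<le> sum_list mu" by (induction mu) auto
    moreover have "x \<in> set mu \<Longrightarrow> x \<le> n" for x
      using member_le_sum_list[of x mu] n by (simp add: psize_def)
    ultimately show "set mu \<subseteq> {..n} \<and> length mu \<le> n"
      using n by (auto simp: psize_def)
  qed
  show "finite {mu. set mu \<subseteq> {..n} \<and> length mu \<le> n}"
    by (rule finite_lists_length_le) auto
qed

text \<open>Every monomial is recovered from its partition. This covering yields the upper bound on
  the number of monomials that the dimension count uses.\<close>

lemma monomials_subset_image_partitions:
  "{m. mweight m < n} \<subseteq> (\<lambda>mu. Abs_poly_mapping (\<lambda>i. count (mset mu) (i + 1))) `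
     {mu. is_partition mu \<and> psize mu < n}"
proof
  fix m assume m: "m \<in> {m. mweight m < n}"
  obtain mu where mu: "is_partition mu" "psize mu = mweight m"
    "\<And>i. Poly_Mapping.lookup m i = count (mset mu) (i + 1)"
    using partition_of_mweight by blast
  have "m = Abs_poly_mapping (\<lambda>i. count (mset mu) (i + 1))"
    unfolding mu(3)[symmetric] by (simp add: lookup_inverse)
  then show "m \<in> (\<lambda>mu. Abs_poly_mapping (\<lambda>i. count (mset mu) (i + 1))) `
     {mu. is_partition mu \<and> psize mu < n}"
    using mu m by auto
qed

lemma finite_mweight_less: "finite {m. mweight m < n}"
  by (rule finite_subset[OF monomials_subset_image_partitions finite_imageI[OF finite_partitions]])

lemma finite_mweight_eq: "finite {m. mweight m = n}"
  by (rule finite_subset[OF _ finite_mweight_less[of "Suc n"]]) auto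

lemma card_monomials_le_card_partitions:
  "card {m. mweight m < n} \<le> card {mu. is_partition mu \<and> psize mu < n}"
  by (rule surj_card_le[OF finite_partitions monomials_subset_image_partitions])

section \<open>Newton's identities for the complete homogeneous functions\<close>

lemma zee_superset:
  assumes "finite S" "Poly_Mapping.keys m \<subseteq> S"
  shows "zee m = (\<Prod>i\<in>S. of_nat (i + 1) ^ Poly_Mapping.lookup m i * of_nat (fact (Poly_Mapping.lookup m i)))"
  unfolding zee_def
  by (rule prod.mono_neutral_left) (use assms in \<open>auto simp: in_keys_iff\<close>)

text \<open>One more part j + 1 adds a factor j + 1 to the power and the new multiplicity to the
  factorial.\<close>

lemma zee_add_single:
  "zee (Poly_Mapping.single j 1 + m) = zee m * of_nat (j + 1) * of_nat (Poly_Mapping.lookup m j + 1)"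
proof -
  let ?S = "insert j (Poly_Mapping.keys m)"
  let ?f = "\<lambda>m i. of_nat (i + 1) ^ Poly_Mapping.lookup m i * of_nat (fact (Poly_Mapping.lookup m i)) :: complex"
  let ?m = "Poly_Mapping.single j 1 + m"
  have fin: "finite ?S" by simp
  have 1: "zee ?m = prod (?f ?m) ?S"
    by (rule zee_superset) (use Poly_Mapping.keys_add[of "Poly_Mapping.single j 1" m] in auto)
  have 2: "zee m = prod (?f m) ?S"
    by (rule zee_superset) auto
  have 3: "prod (?f ?m) (?S - {j}) = prod (?f m) (?S - {j})"
    by (rule prod.cong) (auto simp: lookup_add lookup_single when_def)
  have 4: "?f ?m j = ?f m j * of_nat (j + 1) * of_nat (Poly_Mapping.lookup m j + 1)"
    by (simp add: lookup_add algebra_simps)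
  show ?thesis
    unfolding 1 2 prod.remove[OF fin insertI1] 3 4 by (simp only: mult_ac)
qed

lemma hcomp_0: "hcomp 0 = 1"
  by (simp add: hcomp_def mweight_eq_0_iff zee_def)

text \<open>Double counting of monomials of weight k with a marked part. Removing a part i from m
  leaves m' with 1/z_m' = i * mult / z_m, and the numbers i * mult add up to the weight k.\<close>

lemma newton_hcomp: "of_nat k * hcomp k = (\<Sum>i=1..k. psum i * hcomp (k - i))"
proof -
  let ?e = "\<lambda>j::nat. Poly_Mapping.single j (1::nat)"
  have "(\<Sum>i=1..k. psum i * hcomp (k - i)) =
      (\<Sum>i=1..k. \<Sum>m'\<in>{m'. mweight m' = k - i}. Poly_Mapping.single (?e (i - 1) + m') (1 / zee m'))"
    by (simp add: psum_def hcomp_def sum_distrib_left mult_single)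
  also have "\<dots> = (\<Sum>(i, m')\<in>Sigma {1..k} (\<lambda>i. {m'. mweight m' = k - i}).
      Poly_Mapping.single (?e (i - 1) + m') (1 / zee m'))"
    by (rule sum.Sigma) (auto simp: finite_mweight_eq)
  also have "\<dots> = (\<Sum>(m, j)\<in>Sigma {m. mweight m = k} Poly_Mapping.keys.
      Poly_Mapping.single m (of_nat ((j + 1) * Poly_Mapping.lookup m j) / zee m))"
  \<comment> \<open>The pair (i, m') corresponds to m' with a part i added, marked at that part;
    keys are shifted by one, so the part i has key i - 1.\<close>
  proof (rule sum.reindex_bij_witness[where
        i = "\<lambda>(m, j). (j + 1, m - ?e j)" and j = "\<lambda>(i, m'). (?e (i - 1) + m', i - 1)"])
    fix z assume "z \<in> Sigma {m. mweight m = k} Poly_Mapping.keys"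
    then obtain m j where z: "z = (m, j)" and k: "mweight m = k" and m: "j \<in> Poly_Mapping.keys m"
      by auto
    have e: "?e j + (m - ?e j) = m"
      using m by (intro poly_mapping_eqI) (auto simp: lookup_add lookup_minus lookup_single when_def in_keys_iff)
    show "(case (case z of (m, j) \<Rightarrow> (j + 1, m - ?e j)) of (i, m') \<Rightarrow> (?e (i - 1) + m', i - 1)) = z"
      using e z by simp
    have "mweight m = j + 1 + mweight (m - ?e j)"
      by (subst e[symmetric]) (simp del: One_nat_def)
    then show "(case z of (m, j) \<Rightarrow> (j + 1, m - ?e j)) \<in> Sigma {1..k} (\<lambda>i. {m'. mweight m' = k - i})"
      using k z by auto
  next
    fix z assume "z \<in> Sigma {1..k} (\<lambda>i. {m'. mweight m' = k - i})"
    then obtain i m' where z: "z = (i, m')" and i: "i \<in> {1..k}" and m': "mweight m' = k - i"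
      by auto
    show "(case (case z of (i, m') \<Rightarrow> (?e (i - 1) + m', i - 1)) of (m, j) \<Rightarrow> (j + 1, m - ?e j)) = z"
      using i z by simp
    show "(case z of (i, m') \<Rightarrow> (?e (i - 1) + m', i - 1)) \<in> Sigma {m. mweight m = k} Poly_Mapping.keys"
      using i m' z by (auto simp: in_keys_iff lookup_add)
    have "of_nat (i * Poly_Mapping.lookup (?e (i - 1) + m') (i - 1)) / zee (?e (i - 1) + m') = 1 / zee m'"
    proof -
      have "u \<noteq> 0 \<Longrightarrow> v \<noteq> 0 \<Longrightarrow> u * v / (zee m' * u * v) = 1 / zee m'" for u v
        by simp
      moreover have "Poly_Mapping.lookup (?e (i - 1) + m') (i - 1) = Poly_Mapping.lookup m' (i - 1) + 1"
        and "i - 1 + 1 = i" and "of_nat i \<noteq> (0::complex)"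
        and "of_nat (Poly_Mapping.lookup m' (i - 1) + 1) \<noteq> (0::complex)"
        using i by (simp_all add: lookup_add del: of_nat_Suc of_nat_add)
      ultimately show ?thesis
        unfolding zee_add_single of_nat_mult by (simp only:)
    qed
    then show "(case (case z of (i, m') \<Rightarrow> (?e (i - 1) + m', i - 1)) of (m, j) \<Rightarrow>
          Poly_Mapping.single m (of_nat ((j + 1) * Poly_Mapping.lookup m j) / zee m))
        = (case z of (i, m') \<Rightarrow> Poly_Mapping.single (?e (i - 1) + m') (1 / zee m'))"
      using i by (simp only: z prod.case) (simp del: of_nat_Suc of_nat_add of_nat_mult mult_Suc)
  qed
  also have "\<dots> = (\<Sum>m\<in>{m. mweight m = k}. \<Sum>j\<in>Poly_Mapping.keys m.
      Poly_Mapping.single m (of_nat ((j + 1) * Poly_Mapping.lookup m j) / zee m))"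
    by (rule sum.Sigma[symmetric]) (auto simp: finite_mweight_eq)
  also have "\<dots> = (\<Sum>m\<in>{m. mweight m = k}. of_nat k * Poly_Mapping.single m (1 / zee m))"
  proof (rule sum.cong[OF refl])
    fix m assume m: "m \<in> {m. mweight m = k}"
    have "(\<Sum>j\<in>Poly_Mapping.keys m. Poly_Mapping.single m (of_nat ((j + 1) * Poly_Mapping.lookup m j) / zee m))
        = Poly_Mapping.single m (\<Sum>j\<in>Poly_Mapping.keys m. of_nat ((j + 1) * Poly_Mapping.lookup m j) / zee m)"
      by (rule poly_mapping_eqI) (simp add: lookup_sum lookup_single when_def)
    also have "(\<Sum>j\<in>Poly_Mapping.keys m. of_nat ((j + 1) * Poly_Mapping.lookup m j) / zee m) = of_nat k / zee m"
      using m by (simp only: sum_divide_distrib[symmetric] of_nat_sum[symmetric] mweight_def mem_Collect_eq)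
    also have "Poly_Mapping.single m (of_nat k / zee m) = of_nat k * Poly_Mapping.single m (1 / zee m)"
      unfolding single_of_nat[where 'a = "nat \<Rightarrow>\<^sub>0 nat" and 'b = complex, symmetric]
      by (simp add: mult_single del: single_of_nat)
    finally show "(\<Sum>j\<in>Poly_Mapping.keys m. Poly_Mapping.single m (of_nat ((j + 1) * Poly_Mapping.lookup m j) / zee m))
      = of_nat k * Poly_Mapping.single m (1 / zee m)" .
  qed
  also have "\<dots> = of_nat k * hcomp k"
    by (simp add: hcomp_def sum_distrib_left)
  finally show ?thesis by simp
qed

section \<open>Interpolation and divided differences\<close>

text \<open>The divided difference of \<open>p\<close> at the nodes x_0, ..., x_(N-1), of order N -
  1, in its Lagrange form.\<close>

definition divdiff :: "nat \<Rightarrow> (nat \<Rightarrow> complex) \<Rightarrow> complex poly \<Rightarrow> complex" where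
  "divdiff N x p = (\<Sum>r<N. poly p (x r) / (\<Prod>s\<in>{..<N} - {r}. x r - x s))"

lemma degree_prod_linear: "degree (\<Prod>s\<in>S. [:- f s, 1::complex:]) = card S"
  by (subst degree_prod_eq_sum_degree) auto

lemma coeff_prod_linear: "coeff (\<Prod>s\<in>S. [:- f s, 1::complex:]) (card S) = 1"
  using lead_coeff_prod[of "\<lambda>s. [:- f s, 1::complex:]" S] by (simp add: degree_prod_linear)

text \<open>Both sides have degree below N and agree at N distinct nodes.\<close>

lemma lagrange_interpolation:
  fixes p :: "complex poly"
  assumes inj: "inj_on x {..<N}" and deg: "degree p < N"
  shows "p = (\<Sum>r<N. smult (poly p (x r) / (\<Prod>s\<in>{..<N} - {r}. x r - x s))
    (\<Prod>s\<in>{..<N} - {r}. [:- x s, 1:]))" (is "p = ?q")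
proof (rule poly_eqI_degree)
  show "card (x ` {..<N}) > degree p"
    using inj deg by (simp add: card_image)
  have "degree ?q \<le> N - 1"
  proof (rule degree_sum_le)
    fix r assume "r \<in> {..<N}"
    then show "degree (smult (poly p (x r) / (\<Prod>s\<in>{..<N} - {r}. x r - x s))
        (\<Prod>s\<in>{..<N} - {r}. [:- x s, 1:])) \<le> N - 1"
      by (intro order.trans[OF degree_smult_le]) (simp add: degree_prod_linear)
  qed simp
  then show "card (x ` {..<N}) > degree ?q"
    using inj deg by (simp add: card_image)
  fix y assume "y \<in> x ` {..<N}"
  then obtain k where k: "k < N" "y = x k" by auto
  have "poly ?q y = (\<Sum>r<N. poly p (x r) / (\<Prod>s\<in>{..<N} - {r}. x r - x s)
      * (\<Prod>s\<in>{..<N} - {r}. x k - x s))"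
    by (simp add: poly_sum poly_prod k)
  also have "\<dots> = (\<Sum>r<N. if r = k then poly p (x k) else 0)"
  proof (rule sum.cong[OF refl])
    fix r assume r: "r \<in> {..<N}"
    show "poly p (x r) / (\<Prod>s\<in>{..<N} - {r}. x r - x s) * (\<Prod>s\<in>{..<N} - {r}. x k - x s)
        = (if r = k then poly p (x k) else 0)"
    proof (cases "r = k")
      case True
      have "(\<Prod>s\<in>{..<N} - {k}. x k - x s) \<noteq> 0"
        using inj k by (auto simp: inj_on_def)
      then show ?thesis using True by simp
    next
      case False
      then have "(\<Prod>s\<in>{..<N} - {r}. x k - x s) = 0"
        using k by auto
      then show ?thesis using False by simp
    qed
  qed
  also have "\<dots> = poly p y" using k by simp
  finally show "poly p y = poly ?q y" by simp
qed

text \<open>Compare coefficients of degree N - 1 in Lagrange's formula, whose basis products are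
  monic of that degree.\<close>

lemma divdiff_low_degree:
  assumes inj: "inj_on x {..<N}" and deg: "degree p < N"
  shows "divdiff N x p = coeff p (N - 1)"
proof -
  have "coeff p (N - 1) = (\<Sum>r<N. poly p (x r) / (\<Prod>s\<in>{..<N} - {r}. x r - x s)
      * coeff (\<Prod>s\<in>{..<N} - {r}. [:- x s, 1:]) (N - 1))"
    by (subst lagrange_interpolation[OF inj deg]) (simp add: coeff_sum)
  also have "\<dots> = divdiff N x p"
    unfolding divdiff_def
  proof (rule sum.cong[OF refl])
    fix r assume "r \<in> {..<N}"
    then have "coeff (\<Prod>s\<in>{..<N} - {r}. [:- x s, 1::complex:]) (N - 1) = 1"
      using coeff_prod_linear[of x "{..<N} - {r}"] by simp
    then show "poly p (x r) / (\<Prod>s\<in>{..<N} - {r}. x r - x s) * coeff (\<Prod>s\<in>{..<N} - {r}. [:- x s, 1:]) (N - 1)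
      = poly p (x r) / (\<Prod>s\<in>{..<N} - {r}. x r - x s)" by simp
  qed
  finally show ?thesis by simp
qed

lemma divdiff_sum: "divdiff N x (\<Sum>i\<in>A. f i) = (\<Sum>i\<in>A. divdiff N x (f i))"
  unfolding divdiff_def poly_sum sum_divide_distrib by (rule sum.swap)

lemma divdiff_smult: "divdiff N x (smult c p) = c * divdiff N x p"
  by (simp add: divdiff_def sum_distrib_left)

lemma divdiff_mult:
  "divdiff N x (p * q) = (\<Sum>r<N. (poly p (x r) / (\<Prod>s\<in>{..<N} - {r}. x r - x s)) * poly q (x r))"
  by (simp add: divdiff_def)

section \<open>Partial fractions in the reciprocal variable\<close>

lemma poly_eqI_nonzero:
  fixes p q :: "complex poly"
  assumes "\<And>t. t \<noteq> 0 \<Longrightarrow> poly p t = poly q t"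
  shows "p = q"
proof (rule ccontr)
  assume "p \<noteq> q"
  then have "finite {t. poly (p - q) t = 0}" by (intro poly_roots_finite) simp
  moreover have "UNIV - {0} \<subseteq> {t. poly (p - q) t = 0}" using assms by auto
  ultimately have "finite (UNIV - {0::complex})" by (rule finite_subset[rotated])
  then show False by (simp add: infinite_UNIV_char_0)
qed

lemma poly_prod_reciprocal:
  fixes f :: "'a \<Rightarrow> complex"
  assumes "t \<noteq> 0"
  shows "poly (\<Prod>i\<in>A. [:1, - f i:]) t = t ^ card A * poly (\<Prod>i\<in>A. [:- f i, 1:]) (1 / t)"
proof -
  have "poly (\<Prod>i\<in>A. [:1, - f i:]) t = (\<Prod>i\<in>A. t * (1 / t - f i))"
    using assms by (simp add: poly_prod algebra_simps)
  also have "\<dots> = t ^ card A * poly (\<Prod>i\<in>A. [:- f i, 1:]) (1 / t)"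
    by (simp add: poly_prod prod.distrib)
  finally show ?thesis .
qed

text \<open>This is the partial fraction expansion of the product of the (1 - b_i t)/(1 - x_i t)
  with denominators cleared. It comes from Lagrange interpolation at 1/t, multiplied by t^N.\<close>

lemma partial_fraction_reciprocal:
  fixes x b :: "nat \<Rightarrow> complex"
  assumes inj: "inj_on x {..<N}" and N: "N > 0"
  defines "P \<equiv> \<Prod>i<N. [:- b i, 1:]"
  shows "(\<Prod>i<N. [:1, - b i:]) = (\<Prod>i<N. [:1, - x i:]) + [:0, 1:] *
     (\<Sum>r<N. smult (poly P (x r) / (\<Prod>s\<in>{..<N} - {r}. x r - x s)) (\<Prod>s\<in>{..<N} - {r}. [:1, - x s:]))"
proof (rule poly_eqI_nonzero)
  fix t :: complex assume t: "t \<noteq> 0"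
  let ?Q = "\<Prod>i<N. [:- x i, 1:]"
  let ?w = "\<lambda>r. poly P (x r) / (\<Prod>s\<in>{..<N} - {r}. x r - x s)"
  \<comment> \<open>Both products are monic of degree N, so their difference can be interpolated at
    the N nodes; there \<open>?Q\<close> vanishes and the values are those of
    \<open>P\<close>.\<close>
  have "degree (P - ?Q) \<le> N"
    unfolding P_def by (intro degree_diff_le) (simp_all add: degree_prod_linear)
  moreover have "coeff (P - ?Q) N = 0"
    using coeff_prod_linear[of b "{..<N}"] coeff_prod_linear[of x "{..<N}"] by (simp add: P_def)
  ultimately have deg: "degree (P - ?Q) < N"
    using N by (metis degree_0 leading_coeff_0_iff order_le_less)
  have root: "r < N \<Longrightarrow> poly ?Q (x r) = 0" for r
    by (auto simp: poly_prod)
  note lagrange_interpolation[OF inj deg]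
  also have "(\<Sum>r<N. smult (poly (P - ?Q) (x r) / (\<Prod>s\<in>{..<N} - {r}. x r - x s))
      (\<Prod>s\<in>{..<N} - {r}. [:- x s, 1:])) = (\<Sum>r<N. smult (?w r) (\<Prod>s\<in>{..<N} - {r}. [:- x s, 1:]))"
    by (rule sum.cong) (simp_all add: root)
  finally have "P - ?Q = (\<Sum>r<N. smult (?w r) (\<Prod>s\<in>{..<N} - {r}. [:- x s, 1:]))" .
  from arg_cong[OF this, of "\<lambda>p. poly p (1 / t)"]
  have "poly P (1 / t) - poly ?Q (1 / t) =
      (\<Sum>r<N. ?w r * poly (\<Prod>s\<in>{..<N} - {r}. [:- x s, 1:]) (1 / t))"
    by (simp only: poly_diff poly_sum poly_smult)
  then have "poly P (1 / t) = poly ?Q (1 / t) +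
      (\<Sum>r<N. ?w r * poly (\<Prod>s\<in>{..<N} - {r}. [:- x s, 1:]) (1 / t))"
    by (simp only: diff_eq_eq add.commute)
  then have "t ^ N * poly P (1 / t) = t ^ N * poly ?Q (1 / t) +
      (\<Sum>r<N. t ^ N * (?w r * poly (\<Prod>s\<in>{..<N} - {r}. [:- x s, 1:]) (1 / t)))"
    by (simp only: distrib_left sum_distrib_left)
  also have "(\<Sum>r<N. t ^ N * (?w r * poly (\<Prod>s\<in>{..<N} - {r}. [:- x s, 1:]) (1 / t)))
      = (\<Sum>r<N. t * (?w r * poly (\<Prod>s\<in>{..<N} - {r}. [:1, - x s:]) t))"
  proof (rule sum.cong[OF refl])
    fix r assume "r \<in> {..<N}"
    then show "t ^ N * (?w r * poly (\<Prod>s\<in>{..<N} - {r}. [:- x s, 1:]) (1 / t))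
        = t * (?w r * poly (\<Prod>s\<in>{..<N} - {r}. [:1, - x s:]) t)"
      unfolding poly_prod_reciprocal[OF t] using N
      by (cases N) (simp_all add: mult_ac)
  qed
  finally show "poly (\<Prod>i<N. [:1, - b i:]) t = poly ((\<Prod>i<N. [:1, - x i:]) + [:0, 1:] *
     (\<Sum>r<N. smult (?w r) (\<Prod>s\<in>{..<N} - {r}. [:1, - x s:]))) t"
    using poly_prod_reciprocal[OF t, of b "{..<N}"] poly_prod_reciprocal[OF t, of x "{..<N}"]
    by (simp add: P_def poly_sum sum_distrib_left)
qed

section \<open>Generating functions and the Newton recursion for divided differences\<close>

definition geo :: "complex \<Rightarrow> complex fps" where
  "geo c = Abs_fps (\<lambda>n. c ^ n)"

lemma fps_of_poly_linear_geo: "fps_of_poly [:1, - c:] * geo c = 1"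
proof (rule fps_ext)
  fix n
  have "fps_of_poly [:1, - c:] = 1 - fps_const c * fps_X"
    by (simp add: fps_of_poly_pCons)
  then have "fps_of_poly [:1, - c:] * geo c = geo c - fps_const c * (fps_X * geo c)"
    by (simp only: left_diff_distrib mult.assoc mult_1_left)
  then show "fps_nth (fps_of_poly [:1, - c:] * geo c) n = fps_nth 1 n"
    by (cases n) (simp_all add: geo_def)
qed

text \<open>The logarithmic derivative of a product of factors 1 - c_i t, multiplied out. The
  coefficient of t^k with k > 0 in the sum on the right is the power sum of the c_i.\<close>

lemma fps_log_deriv_prod_linear:
  fixes c :: "nat \<Rightarrow> complex"
  shows "fps_X * fps_deriv (fps_of_poly (\<Prod>i<N. [:1, - c i:])) =
    - (fps_of_poly (\<Prod>i<N. [:1, - c i:]) * (\<Sum>i<N. fps_X * fps_const (c i) * geo (c i)))"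
proof (induction N)
  case (Suc N)
  let ?A = "fps_of_poly (\<Prod>i<N. [:1, - c i:])" and ?l = "fps_of_poly [:1, - c N:]"
  let ?S = "\<Sum>i<N. fps_X * fps_const (c i) * geo (c i)"
  have l: "fps_deriv ?l = - fps_const (c N)"
    by (simp add: fps_of_poly_pCons)
  have "fps_X * fps_deriv (?A * ?l) = (fps_X * fps_deriv ?A) * ?l - ?A * fps_X * fps_const (c N)"
    by (simp add: l algebra_simps)
  also have "\<dots> = - (?A * ?S) * ?l - ?A * fps_X * fps_const (c N) * (?l * geo (c N))"
    unfolding Suc.IH fps_of_poly_linear_geo by simp
  also have "\<dots> = - ((?A * ?l) * (?S + fps_X * fps_const (c N) * geo (c N)))"
    by (simp add: algebra_simps)
  finally show ?case by (simp only: prod.lessThan_Suc fps_of_poly_mult sum.lessThan_Suc)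
qed simp

text \<open>The numbers \<open>g k\<close> are the coefficients of the product of the (1 - b_i t)/(1
  - x_i t). Taking its logarithmic derivative gives Newton's recursion for the power sums of x minus
  those of b.\<close>

lemma newton_divdiff:
  fixes x b :: "nat \<Rightarrow> complex"
  assumes inj: "inj_on x {..<N}" and N: "N > 0"
  defines "g \<equiv> \<lambda>k. if k = 0 then 1 else divdiff N x ((\<Prod>i<N. [:- b i, 1:]) * monom 1 (k - 1))"
  shows "of_nat k * g k = (\<Sum>i=1..k. (\<Sum>r<N. x r ^ i - b r ^ i) * g (k - i))"
proof -
  let ?P = "\<Prod>i<N. [:- b i, 1:]"
  let ?w = "\<lambda>r. poly ?P (x r) / (\<Prod>s\<in>{..<N} - {r}. x r - x s)"
  let ?B = "fps_of_poly (\<Prod>i<N. [:1, - b i:])" and ?X = "fps_of_poly (\<Prod>i<N. [:1, - x i:])"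
  \<comment> \<open>\<open>G\<close> is written in partial fractions; multiplying by
    \<open>?X\<close> will identify it with \<open>?B\<close> / \<open>?X\<close>.\<close>
  define G where "G = 1 + fps_X * (\<Sum>r<N. fps_const (?w r) * geo (x r))"
  have G_nth: "fps_nth G n = g n" for n
    by (cases n) (simp_all add: G_def g_def geo_def divdiff_def fps_sum_nth poly_monom)
  have geo: "?X * geo (x r) = fps_of_poly (\<Prod>s\<in>{..<N} - {r}. [:1, - x s:])" if "r < N" for r
  proof -
    have "?X = fps_of_poly [:1, - x r:] * fps_of_poly (\<Prod>s\<in>{..<N} - {r}. [:1, - x s:])"
      using that by (subst prod.remove[of _ r]) (simp_all only: fps_of_poly_mult finite_lessThan lessThan_iff)
    then have "?X * geo (x r) = (fps_of_poly [:1, - x r:] * geo (x r)) *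
        fps_of_poly (\<Prod>s\<in>{..<N} - {r}. [:1, - x s:])"
      by (simp only: mult_ac)
    then show ?thesis
      by (simp only: fps_of_poly_linear_geo mult_1_left)
  qed
  have "G * ?X = ?X + fps_X * (\<Sum>r<N. fps_const (?w r) * (?X * geo (x r)))"
  proof -
    have "(\<Sum>r<N. fps_const (?w r) * geo (x r)) * ?X = (\<Sum>r<N. fps_const (?w r) * (?X * geo (x r)))"
      unfolding sum_distrib_right by (rule sum.cong) (simp_all only: mult_ac)
    then show ?thesis
      by (simp only: G_def distrib_right mult_1_left mult.assoc)
  qed
  also have "(\<Sum>r<N. fps_const (?w r) * (?X * geo (x r))) =
      (\<Sum>r<N. fps_const (?w r) * fps_of_poly (\<Prod>s\<in>{..<N} - {r}. [:1, - x s:]))"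
    by (rule sum.cong) (simp_all only: geo lessThan_iff)
  also have "?X + fps_X * \<dots> = ?B"
    unfolding partial_fraction_reciprocal[OF inj N, of b]
    by (simp add: fps_of_poly_add fps_of_poly_mult fps_of_poly_sum fps_of_poly_smult fps_of_poly_pCons)
  finally have GX: "G * ?X = ?B" .
  let ?LX = "\<Sum>i<N. fps_X * fps_const (x i) * geo (x i)" and ?LB = "\<Sum>i<N. fps_X * fps_const (b i) * geo (b i)"
  \<comment> \<open>The logarithmic derivative of a quotient, obtained by differentiating
    \<open>G * ?X = ?B\<close> and then cancelling \<open>?X\<close>.\<close>
  have "?X * (fps_X * fps_deriv G) = fps_X * fps_deriv (G * ?X) - G * (fps_X * fps_deriv ?X)"
    by (simp add: algebra_simps)
  also have "\<dots> = ?X * (G * (?LX - ?LB))"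
    unfolding GX fps_log_deriv_prod_linear by (simp add: GX[symmetric] algebra_simps)
  finally have "fps_X * fps_deriv G = G * (?LX - ?LB)"
  proof (rule mult_left_cancel[THEN iffD1, rotated])
    show "?X \<noteq> 0" by (simp add: prod_zero_iff)
  qed
  then have "fps_nth (fps_X * fps_deriv G) k = fps_nth ((?LX - ?LB) * G) k"
    by (simp add: mult.commute)
  moreover have "fps_nth (fps_X * fps_deriv G) k = of_nat k * g k"
    by (cases k) (simp_all add: G_nth)
  moreover have L: "fps_nth (?LX - ?LB) i = (if i = 0 then 0 else \<Sum>r<N. x r ^ i - b r ^ i)" for i
    by (cases i) (simp_all add: fps_sum_nth geo_def sum_subtractf mult.assoc)
  ultimately have "of_nat k * g k = (\<Sum>i=0..k. (if i = 0 then 0 else \<Sum>r<N. x r ^ i - b r ^ i) * g (k - i))"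
    by (simp only: fps_mult_nth G_nth L)
  also have "\<dots> = (\<Sum>i=1..k. (if i = 0 then 0 else \<Sum>r<N. x r ^ i - b r ^ i) * g (k - i))"
    by (rule sum.mono_neutral_right) auto
  also have "\<dots> = (\<Sum>i=1..k. (\<Sum>r<N. x r ^ i - b r ^ i) * g (k - i))"
    by (rule sum.cong) auto
  finally show ?thesis .
qed

section \<open>Combinatorics of partitions\<close>

lemma part_antimono:
  assumes "is_partition lam" "1 \<le> i" "i \<le> j"
  shows "part lam j \<le> part lam i"
proof (cases "i < j \<and> j \<le> length lam")
  case True
  then show ?thesis
    using assms sorted_wrt_nth_less[of "(\<ge>)" lam "i - 1" "j - 1"]
    by (auto simp: part_def is_partition_def)
qed (use assms in \<open>auto simp: part_def\<close>)

text \<open>Turns the cardinalities defining \<open>conjpart\<close> and \<open>frob_d\<close> into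
  membership criteria.\<close>

lemma down_closed_eq_atLeastAtMost:
  fixes S :: "nat set"
  assumes "finite S" "0 \<notin> S" "\<And>i k. i \<in> S \<Longrightarrow> 1 \<le> k \<Longrightarrow> k \<le> i \<Longrightarrow> k \<in> S"
  shows "S = {1..card S}"
proof (cases "S = {}")
  case False
  then have "Max S \<in> S" using assms(1) by simp
  then have "S = {1..Max S}"
    using assms by (auto simp: Suc_le_eq gr0_conv_Suc[symmetric] intro!: gr0I)
  then show ?thesis by (metis card_atLeastAtMost diff_Suc_1)
qed simp

text \<open>Both sides say that the box (i, j) lies in the diagram, since the rows of length at
  least j form an initial segment. Rows past the end have length 0, excluded by j being
  positive.\<close>

lemma le_conjpart_iff:
  assumes "is_partition lam" "1 \<le> i" "1 \<le> j"
  shows "i \<le> conjpart lam j \<longleftrightarrow> j \<le> part lam i"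
proof -
  let ?S = "{i\<in>{1..length lam}. j \<le> part lam i}"
  have "?S = {1..card ?S}"
    by (rule down_closed_eq_atLeastAtMost)
      (use part_antimono[OF assms(1)] in \<open>auto intro: order.trans\<close>)
  from arg_cong[OF this, of "\<lambda>X. i \<in> X"]
  have "i \<in> ?S \<longleftrightarrow> i \<le> conjpart lam j"
    unfolding conjpart_def using assms(2) by (simp only: atLeastAtMost_iff simp_thms)
  moreover have "i \<in> ?S \<longleftrightarrow> j \<le> part lam i"
    using assms(2,3) by (auto simp: part_def)
  ultimately show ?thesis by simp
qed

lemma conjpart_le_length: "conjpart lam j \<le> length lam"
  unfolding conjpart_def by (rule order.trans[OF card_mono[of "{1..length lam}"]]) auto

lemma conjpart_antimono: "j \<le> j' \<Longrightarrow> conjpart lam j' \<le> conjpart lam j"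
  unfolding conjpart_def by (rule card_mono) auto

lemma le_frob_d_iff:
  assumes "is_partition lam" "1 \<le> i"
  shows "i \<le> frob_d lam \<longleftrightarrow> i \<le> part lam i"
proof -
  let ?S = "{i\<in>{1..length lam}. i \<le> part lam i}"
  have "?S = {1..card ?S}"
  proof (rule down_closed_eq_atLeastAtMost)
    fix i k assume "i \<in> ?S" "1 \<le> k" "k \<le> i"
    then show "k \<in> ?S" using part_antimono[OF assms(1), of k i] by auto
  qed auto
  from arg_cong[OF this, of "\<lambda>X. i \<in> X"]
  have "i \<in> ?S \<longleftrightarrow> i \<le> frob_d lam"
    unfolding frob_d_def using assms(2) by (simp only: atLeastAtMost_iff simp_thms)
  moreover have "i \<in> ?S \<longleftrightarrow> i \<le> part lam i"
    using assms(2) by (auto simp: part_def)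
  ultimately show ?thesis by simp
qed

lemma frob_d_le_length: "frob_d lam \<le> length lam"
  unfolding frob_d_def by (rule order.trans[OF card_mono[of "{1..length lam}"]]) auto

text \<open>Rows are counted from 0, so this is the index lambda_i - i + 1 of the usual numbering,
  and \<open>a (beta lam i)\<close> is x_i; past the length it is \<open>- int i\<close>.\<close>

definition beta :: "nat list \<Rightarrow> nat \<Rightarrow> int" where
  "beta lam i = int (part lam (Suc i)) - int i"

lemma beta_strict_antimono: "is_partition lam \<Longrightarrow> i < j \<Longrightarrow> beta lam j < beta lam i"
  using part_antimono[of lam "Suc i" "Suc j"] by (simp add: beta_def)

lemma inj_beta: "is_partition lam \<Longrightarrow> inj (beta lam)"
  by (rule injI) (metis beta_strict_antimono linorder_neqE_nat order_less_irrefl)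

text \<open>The boundary path of a diagram: its vertical steps carry the labels \<^term>\<open>beta lam i\<close>, its
  horizontal steps the labels \<open>j - \<lambda>'\<^sub>j\<close>, and together they number an interval without gaps.\<close>

lemma boundary_labels:
  assumes lam: "is_partition lam" "length lam \<le> N" and r: "r \<le> N"
    and c: "part lam (Suc r) \<le> c" "r = 0 \<or> c \<le> part lam r"
  defines "gam \<equiv> \<lambda>j. int j - int (conjpart lam j)"
  shows "beta lam ` {r..<N} \<union> gam ` {1..c} = {1 - int N..int c - int r}"
    and "beta lam ` {r..<N} \<inter> gam ` {1..c} = {}"
    and "inj_on gam {1..c}"
proof -
  show inj: "inj_on gam {1..c}"
  proof (rule inj_onI)
    fix j j' assume "gam j = gam j'"
    then show "j = j'"
      using conjpart_antimono[of j j' lam] conjpart_antimono[of j' j lam]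
      by (cases j j' rule: linorder_cases) (auto simp: gam_def)
  qed
  \<comment> \<open>Equal labels would give lambda_(i+1) + lambda'_j = i + j. The left side is
    larger if the box (i + 1, j) lies in the diagram and smaller if it does not.\<close>
  show disj: "beta lam ` {r..<N} \<inter> gam ` {1..c} = {}"
  proof (rule equals0I, clarify)
    fix i j assume "j \<in> {1..c}" "beta lam i = gam j"
    then show False
      using le_conjpart_iff[OF lam(1), of "Suc i" j] by (auto simp: beta_def gam_def)
  qed
  have sub: "beta lam ` {r..<N} \<union> gam ` {1..c} \<subseteq> {1 - int N..int c - int r}"
  proof (rule Un_least; clarify)
    fix i assume i: "i \<in> {r..<N}"
    then have "part lam (Suc i) \<le> part lam (Suc r)"
      using part_antimono[OF lam(1), of "Suc r" "Suc i"] by simp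
    then show "beta lam i \<in> {1 - int N..int c - int r}"
      using i c by (auto simp: beta_def)
  next
    fix j assume j: "j \<in> {1..c}"
    have "r \<le> conjpart lam j"
      using c(2) le_conjpart_iff[OF lam(1), of r j] j by (cases "r = 0") auto
    then show "gam j \<in> {1 - int N..int c - int r}"
      using j conjpart_le_length[of lam j] lam(2) by (auto simp: gam_def)
  qed
  \<comment> \<open>The labels lie in the interval and are as many as its elements, so they exhaust
    it.\<close>
  have "card (beta lam ` {r..<N} \<union> gam ` {1..c}) = card (beta lam ` {r..<N}) + card (gam ` {1..c})"
    by (rule card_Un_disjoint) (use disj in auto)
  also have "\<dots> = N - r + c"
    using inj inj_beta[OF lam(1)] by (simp add: card_image inj_on_subset)
  also have "\<dots> = card {1 - int N..int c - int r}"
    using r by simp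
  finally show "beta lam ` {r..<N} \<union> gam ` {1..c} = {1 - int N..int c - int r}"
    by (intro card_subset_eq sub) auto
qed

text \<open>Serves the diagonal value, with r = i + 1 and c the length of that row. The sum version
  serves the power sums, with r = c the side of the Durfee square.\<close>

lemma prod_boundary_labels:
  assumes "is_partition lam" "length lam \<le> N" "r \<le> N"
    and "part lam (Suc r) \<le> c" "r = 0 \<or> c \<le> part lam r"
  shows "(\<Prod>l\<in>{1 - int N..int c - int r}. f l) =
    (\<Prod>i\<in>{r..<N}. f (beta lam i)) * (\<Prod>j\<in>{1..c}. f (int j - int (conjpart lam j)))"
  unfolding boundary_labels(1)[OF assms, symmetric]
  by (subst prod.union_disjoint)
    (use boundary_labels(2)[OF assms] boundary_labels(3)[OF assms] inj_beta[OF assms(1)] in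
      \<open>auto simp: prod.reindex inj_on_subset\<close>)

lemma sum_boundary_labels:
  assumes "is_partition lam" "length lam \<le> N" "r \<le> N"
    and "part lam (Suc r) \<le> c" "r = 0 \<or> c \<le> part lam r"
  shows "(\<Sum>l\<in>{1 - int N..int c - int r}. f l) =
    (\<Sum>i\<in>{r..<N}. f (beta lam i)) + (\<Sum>j\<in>{1..c}. f (int j - int (conjpart lam j)))"
  unfolding boundary_labels(1)[OF assms, symmetric]
  by (subst sum.union_disjoint)
    (use boundary_labels(2)[OF assms] boundary_labels(3)[OF assms] inj_beta[OF assms(1)] in
      \<open>auto simp: sum.reindex inj_on_subset\<close>)

lemma atLeastAtMost_neg_image: "{1 - int N..0} = (\<lambda>i. - int i) ` {..<N}"
proof (intro equalityI subsetI)
  fix l assume "l \<in> {1 - int N..0}"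
  then have "l = - int (nat (- l))" "nat (- l) \<in> {..<N}" by auto
  then show "l \<in> (\<lambda>i. - int i) ` {..<N}" by (rule image_eqI)
qed auto

lemma inj_on_neg_int: "inj_on (\<lambda>i. - int i) A"
  by (rule inj_onI) simp

text \<open>Replaces Frobenius coordinates by all N rows. Since y_j = -a_(j - lambda'_j), the signs
  make it contribute -a_(j - lambda'_j)^k; the rows below the Durfee square and its columns together
  carry the labels from 1 - N to 0.\<close>

lemma peval_frobenius:
  assumes lam: "is_partition lam" "length lam \<le> N" and k: "k \<ge> 1"
  shows "peval k (xpt lam a) (ypt lam a) = (\<Sum>i<N. a (beta lam i) ^ k - a (- int i) ^ k)"
proof -
  let ?d = "frob_d lam"
  have dN: "?d \<le> N" using frob_d_le_length[of lam] lam(2) by simp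
  have x: "(\<Sum>x\<leftarrow>xpt lam a. x ^ k) = (\<Sum>i<?d. a (beta lam i) ^ k)"
  proof -
    have "(\<Sum>x\<leftarrow>xpt lam a. x ^ k) = (\<Sum>i\<in>{1..<?d + 1}. a (int (part lam i) - int i + 1) ^ k)"
      by (simp add: xpt_def comp_def interv_sum_list_conv_sum_set_nat del: upt_Suc)
    also have "\<dots> = (\<Sum>i<?d. a (beta lam i) ^ k)"
      by (rule sum.reindex_bij_witness[where i = Suc and j = "\<lambda>i. i - 1"]) (auto simp: beta_def of_nat_diff algebra_simps)
    finally show ?thesis .
  qed
  have "(\<Sum>y\<leftarrow>ypt lam a. y ^ k) = (\<Sum>j\<in>{1..?d}. (- a (int j - int (conjpart lam j))) ^ k)"
  proof -
    have "1 - (int (conjpart lam j) - int j + 1) = int j - int (conjpart lam j)" for j by simp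
    then show ?thesis
      by (simp only: ypt_def map_map comp_def interv_sum_list_conv_sum_set_nat set_upt
        Suc_eq_plus1[symmetric] atLeastLessThanSuc_atLeastAtMost)
  qed
  then have "(-1) ^ (k - 1) * (\<Sum>y\<leftarrow>ypt lam a. y ^ k) =
      (\<Sum>j\<in>{1..?d}. (-1) ^ (k - 1) * (- a (int j - int (conjpart lam j))) ^ k)"
    by (simp add: sum_distrib_left)
  also have "\<dots> = - (\<Sum>j\<in>{1..?d}. a (int j - int (conjpart lam j)) ^ k)"
    unfolding sum_negf[symmetric]
  proof (rule sum.cong[OF refl])
    fix j
    obtain k' where k': "k = Suc k'" using k by (cases k) auto
    have "(-1) ^ k' * (- z) ^ Suc k' = - (z ^ Suc k')" for z :: complex
      by (cases "even k'") simp_all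
    then show "(-1) ^ (k - 1) * (- a (int j - int (conjpart lam j))) ^ k = - (a (int j - int (conjpart lam j)) ^ k)"
      unfolding k' by (simp only: diff_Suc_1)
  qed
  finally have y: "(-1) ^ (k - 1) * (\<Sum>y\<leftarrow>ypt lam a. y ^ k) =
    - (\<Sum>j\<in>{1..?d}. a (int j - int (conjpart lam j)) ^ k)" .
  \<comment> \<open>The corner of the Durfee square lies on the boundary path, and there the
    interval of labels ends at 0.\<close>
  have "part lam (Suc ?d) \<le> ?d" "?d = 0 \<or> ?d \<le> part lam ?d"
    using le_frob_d_iff[OF lam(1), of "Suc ?d"] le_frob_d_iff[OF lam(1), of ?d] by auto
  from sum_boundary_labels[OF lam dN this, of "\<lambda>l. a l ^ k"]
  have b: "(\<Sum>i<N. a (- int i) ^ k) =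
      (\<Sum>i\<in>{?d..<N}. a (beta lam i) ^ k) + (\<Sum>j\<in>{1..?d}. a (int j - int (conjpart lam j)) ^ k)"
    by (simp add: atLeastAtMost_neg_image sum.reindex inj_on_neg_int comp_def)
  have "(\<Sum>i<N. a (beta lam i) ^ k) = (\<Sum>i<?d. a (beta lam i) ^ k) + (\<Sum>i\<in>{?d..<N}. a (beta lam i) ^ k)"
    unfolding lessThan_atLeast0 using dN by (simp add: sum.atLeastLessThan_concat)
  then show ?thesis
    unfolding peval_def x y sum_subtractf b by simp
qed

section \<open>Evaluation of the complete homogeneous functions\<close>

text \<open>Both sides start with 1 and obey Newton's recursion with the same power sums; for k > 0
  the factor k can be cancelled.\<close>

lemma seval_hcomp:
  fixes a :: "int \<Rightarrow> complex"
  assumes "inj a" and lam: "is_partition lam" "length lam \<le> N" and N: "N > 0"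
  shows "seval (hcomp k) (xpt lam a) (ypt lam a) = (if k = 0 then 1 else
    divdiff N (\<lambda>i. a (beta lam i)) ((\<Prod>i<N. [:- a (- int i), 1:]) * monom 1 (k - 1)))"
    (is "?h k = ?g k")
proof (induction k rule: less_induct)
  case (less k)
  show ?case
  proof (cases "k = 0")
    case True
    then show ?thesis by (simp add: hcomp_0)
  next
    case False
    have inj: "inj_on (\<lambda>i. a (beta lam i)) {..<N}"
      using assms(1) inj_beta[OF lam(1)] by (auto simp: inj_def inj_on_def)
    have "of_nat k * ?h k = seval (of_nat k * hcomp k) (xpt lam a) (ypt lam a)" by simp
    also have "\<dots> = (\<Sum>i=1..k. peval i (xpt lam a) (ypt lam a) * ?h (k - i))"
      unfolding newton_hcomp by (simp add: seval_sum seval_psum)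
    also have "\<dots> = (\<Sum>i=1..k. (\<Sum>r<N. a (beta lam r) ^ i - a (- int r) ^ i) * ?g (k - i))"
    proof (rule sum.cong[OF refl])
      fix i assume "i \<in> {1..k}"
      then show "peval i (xpt lam a) (ypt lam a) * ?h (k - i)
          = (\<Sum>r<N. a (beta lam r) ^ i - a (- int r) ^ i) * ?g (k - i)"
        using less.IH[of "k - i"] peval_frobenius[OF lam, of i a] by simp
    qed
    also have "\<dots> = of_nat k * ?g k"
      by (rule newton_divdiff[OF inj N, symmetric])
    finally show ?thesis using False by simp
  qed
qed

text \<open>Vieta's formula: expand the product over subsets and group them by size.\<close>

lemma prod_linear_esym:
  assumes "finite A"
  shows "(\<Prod>l\<in>A. [:- f l, 1:]) = (\<Sum>r\<le>card A. smult ((-1) ^ r * esym r A f) (monom 1 (card A - r)))"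
proof -
  have const: "(\<Prod>l\<in>X. [:- f l:]) = [:(-1) ^ card X * prod f X:]" for X
    by (induction X rule: infinite_finite_induct) auto
  have "(\<Prod>l\<in>A. [:- f l, 1:]) = (\<Prod>l\<in>A. [:- f l:] + monom 1 1)"
    by (simp add: monom_altdef)
  also have "\<dots> = (\<Sum>X\<in>Pow A. (\<Prod>l\<in>X. [:- f l:]) * (\<Prod>l\<in>A - X. monom 1 1))"
    by (rule prod_add[OF assms])
  also have "\<dots> = (\<Sum>X\<in>Pow A. smult ((-1) ^ card X * prod f X) (monom 1 (card A - card X)))"
    by (rule sum.cong)
      (auto simp: const monom_power card_Diff_subset finite_subset[OF _ assms])
  also have "\<dots> = (\<Sum>r\<le>card A. \<Sum>X\<in>{X\<in>Pow A. card X = r}.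
      smult ((-1) ^ card X * prod f X) (monom 1 (card A - card X)))"
    by (rule sum.group[symmetric]) (use assms in \<open>auto intro: card_mono\<close>)
  also have "\<dots> = (\<Sum>r\<le>card A. smult ((-1) ^ r * esym r A f) (monom 1 (card A - r)))"
    by (rule sum.cong) (auto simp: esym_def sum_distrib_left smult_sum Pow_def)
  finally show ?thesis .
qed

text \<open>In the determinant k - j depends only on the row, so the first product depends on the
  row and the second on the column: this is what makes the matrix factor.\<close>

lemma seval_hfac:
  fixes a :: "int \<Rightarrow> complex"
  assumes "inj a" and lam: "is_partition lam" "length lam \<le> N" and j: "j < N"
    and k: "int j + 1 - int N \<le> k"
  shows "seval (hfac k (shiftseq (- int j) a)) (xpt lam a) (ypt lam a) =
    divdiff N (\<lambda>i. a (beta lam i))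
      ((\<Prod>l\<in>{1 - int N..k - int j - 1}. [:- a l, 1:]) * (\<Prod>l\<in>{1 - int j..0}. [:- a l, 1:]))"
    (is "?L = divdiff N ?x (?A * ?V)")
proof (cases "k \<ge> 1")
  case True
  define n where "n = nat k - 1"
  have kn: "k = int n + 1" "nat k = Suc n" using True by (auto simp: n_def)
  let ?P = "\<Prod>i<N. [:- a (- int i), 1:]"
  let ?b = "shiftseq (- int j) a"
  let ?e = "\<lambda>r. (-1) ^ r * esym r {1..n} (\<lambda>l. ?b (int l))"
  have N: "N > 0" using j by simp
  have "hfac k ?b = (\<Sum>i\<in>{1..Suc n}. lconst (?e (Suc n - i)) * hcomp i)"
    unfolding hfac_def kn(2) using True by simp
  then have "?L = (\<Sum>i\<in>{1..Suc n}. seval (lconst (?e (Suc n - i)) * hcomp i) (xpt lam a) (ypt lam a))"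
    by (simp only: seval_sum)
  also have "\<dots> = (\<Sum>i\<in>{1..Suc n}. ?e (Suc n - i) * divdiff N ?x (?P * monom 1 (i - 1)))"
    by (rule sum.cong) (auto simp: seval_hcomp[OF assms(1) lam N])
  also have "\<dots> = (\<Sum>r\<le>n. ?e r * divdiff N ?x (?P * monom 1 (n - r)))"
    by (rule sum.reindex_bij_witness[where i = "\<lambda>r. Suc n - r" and j = "\<lambda>i. Suc n - i"])
      (auto simp: Suc_diff_le)
  \<comment> \<open>The signed elementary symmetric functions in \<open>hfac\<close> are the
    coefficients of a product of linear factors, which linearity moves inside the divided
    difference.\<close>
  also have "\<dots> = divdiff N ?x (?P * (\<Prod>l\<in>{1..n}. [:- ?b (int l), 1:]))"
  proof -
    have "?P * (\<Prod>l\<in>{1..n}. [:- ?b (int l), 1:]) = (\<Sum>r\<le>n. smult (?e r) (?P * monom 1 (n - r)))"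
      by (simp only: prod_linear_esym finite_atLeastAtMost card_atLeastAtMost diff_Suc_1
          sum_distrib_left mult_smult_right)
    then show ?thesis by (simp only: divdiff_sum divdiff_smult)
  qed
  also have "(\<Prod>l\<in>{1..n}. [:- ?b (int l), 1:]) = (\<Prod>l\<in>{1 - int j..k - int j - 1}. [:- a l, 1:])"
    by (rule prod.reindex_bij_witness[where i = "\<lambda>l. nat (l + int j)" and j = "\<lambda>l. int l - int j"])
      (auto simp: kn shiftseq_def)
  also have "?P = (\<Prod>l\<in>{1 - int N..0}. [:- a l, 1:])"
    by (simp add: atLeastAtMost_neg_image prod.reindex inj_on_neg_int)
  \<comment> \<open>Split at -j: the lower labels join those of the shifted sequence to form one
    interval ending at k - j - 1, the upper ones give \<open>?V\<close>.\<close>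
  also have "{1 - int N..0} = {1 - int N..- int j} \<union> {1 - int j..0}"
    using j by auto
  also have "(\<Prod>l\<in>\<dots>. [:- a l, 1:]) = (\<Prod>l\<in>{1 - int N..- int j}. [:- a l, 1:]) * ?V"
    by (rule prod.union_disjoint) auto
  also have "\<dots> * (\<Prod>l\<in>{1 - int j..k - int j - 1}. [:- a l, 1:]) =
      ((\<Prod>l\<in>{1 - int N..- int j}. [:- a l, 1:]) * (\<Prod>l\<in>{1 - int j..k - int j - 1}. [:- a l, 1:])) * ?V"
    by (simp only: mult_ac)
  also have "(\<Prod>l\<in>{1 - int N..- int j}. [:- a l, 1:]) * (\<Prod>l\<in>{1 - int j..k - int j - 1}. [:- a l, 1:]) = ?A"
  proof -
    have "{1 - int N..k - int j - 1} = {1 - int N..- int j} \<union> {1 - int j..k - int j - 1}"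
      using j True by auto
    then show ?thesis by (simp add: prod.union_disjoint)
  qed
  finally show ?thesis .
next
  case False
  \<comment> \<open>The intervals have N + k - j - 1 and j elements. For k \<le> 0 the degree is
    below N, so only the coefficient of degree N - 1 matters: the leading 1 if k = 0, and 0 if k <
    0.\<close>
  let ?m = "nat (int N + k - 1)"
  have "card {1 - int N..k - int j - 1} + card {1 - int j..0} = ?m"
    using k by (simp add: nat_add_distrib[symmetric])
  moreover have "degree (?A * ?V) = degree ?A + degree ?V"
    by (rule degree_mult_eq) auto
  ultimately have deg: "degree (?A * ?V) = ?m"
    by (simp add: degree_prod_linear)
  have lead: "coeff (?A * ?V) ?m = 1"
    using lead_coeff_mult[of ?A ?V] unfolding deg
    by (simp add: lead_coeff_prod)
  have inj: "inj_on ?x {..<N}"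
    using assms(1) inj_beta[OF lam(1)] by (auto simp: inj_def inj_on_def)
  have "degree (?A * ?V) < N"
    using False j deg by auto
  from divdiff_low_degree[OF inj this]
  have "divdiff N ?x (?A * ?V) = coeff (?A * ?V) (N - 1)" .
  also have "\<dots> = (if k = 0 then 1 else 0)"
  proof (cases "k = 0")
    case True
    then have "?m = N - 1" by auto
    then show ?thesis using lead True by simp
  next
    case False
    then have "?m < N - 1" using \<open>\<not> k \<ge> 1\<close> k j by auto
    then show ?thesis using deg False by (simp add: coeff_eq_0)
  qed
  also have "\<dots> = ?L" using False by (simp add: hfac_def)
  finally show ?thesis by simp
qed

section \<open>Determinants\<close>

text \<open>Gives access to the multiplicativity of the determinant.\<close>

lemma ldet_eq_det: "ldet N M = Determinant.det (Matrix.mat N N (\<lambda>(i, j). M i j))"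
  unfolding ldet_def Determinant.det_def dim_row_mat dim_col_mat if_P[OF refl] lessThan_atLeast0[symmetric]
proof (rule sum.cong[OF refl])
  fix \<sigma> assume "\<sigma> \<in> {\<sigma>. \<sigma> permutes {..<N}}"
  then have "i < N \<Longrightarrow> \<sigma> i < N" for i
    using permutes_in_image[of \<sigma> "{..<N}" i] by auto
  then show "of_int (sign \<sigma>) * (\<Prod>i<N. M i (\<sigma> i)) =
      of_int (sign \<sigma>) * (\<Prod>i<N. Matrix.mat N N (\<lambda>(i, j). M i j) $$ (i, \<sigma> i))"
    by (auto intro!: arg_cong[where f = "\<lambda>u. _ * u"] prod.cong)
qed

lemma ldet_mult: "ldet N A * ldet N B = ldet N (\<lambda>i j. \<Sum>r<N. A i r * B r j)"
proof -
  let ?A = "Matrix.mat N N (\<lambda>(i, j). A i j)" and ?B = "Matrix.mat N N (\<lambda>(i, j). B i j)"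
  have "?A * ?B = Matrix.mat N N (\<lambda>(i, j). \<Sum>r<N. A i r * B r j)"
    by (rule eq_matI) (auto simp: scalar_prod_def lessThan_atLeast0)
  then show ?thesis
    unfolding ldet_eq_det by (simp add: det_mult[where n = N, symmetric])
qed

lemma ldet_eq_0I:
  assumes "\<And>\<sigma>. \<sigma> permutes {..<N} \<Longrightarrow> \<exists>i<N. M i (\<sigma> i) = 0"
  shows "ldet N M = 0"
  unfolding ldet_def
proof (rule sum.neutral, rule ballI)
  fix \<sigma> assume "\<sigma> \<in> {\<sigma>. \<sigma> permutes {..<N}}"
  then obtain i where "i < N" "M i (\<sigma> i) = 0" using assms by auto
  then have "(\<Prod>i<N. M i (\<sigma> i)) = 0" by (intro prod_zero) auto
  then show "of_int (sign \<sigma>) * (\<Prod>i<N. M i (\<sigma> i)) = 0" by simp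
qed

lemma ldet_only_id:
  assumes "\<And>\<sigma>. \<sigma> permutes {..<N} \<Longrightarrow> \<sigma> \<noteq> id \<Longrightarrow> \<exists>i<N. M i (\<sigma> i) = 0"
  shows "ldet N M = (\<Prod>i<N. M i i)"
proof -
  have "ldet N M = (\<Sum>\<sigma>\<in>{id}. of_int (sign \<sigma>) * (\<Prod>i<N. M i (\<sigma> i)))"
    unfolding ldet_def
  proof (rule sum.mono_neutral_right)
    show "\<forall>\<sigma>\<in>{\<sigma>. \<sigma> permutes {..<N}} - {id}. of_int (sign \<sigma>) * (\<Prod>i<N. M i (\<sigma> i)) = 0"
    proof
      fix \<sigma> assume "\<sigma> \<in> {\<sigma>. \<sigma> permutes {..<N}} - {id}"
      then obtain i where "i < N" "M i (\<sigma> i) = 0" using assms by auto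
      then have "(\<Prod>i<N. M i (\<sigma> i)) = 0" by (intro prod_zero) auto
      then show "of_int (sign \<sigma>) * (\<Prod>i<N. M i (\<sigma> i)) = 0" by simp
    qed
  qed (auto simp: finite_permutations permutes_id)
  then show ?thesis by simp
qed

text \<open>A permutation other than the identity moves some index upwards and so meets a zero
  entry.\<close>

lemma ldet_lower_triangular:
  assumes "\<And>i r. i < r \<Longrightarrow> r < N \<Longrightarrow> M i r = 0"
  shows "ldet N M = (\<Prod>i<N. M i i)"
proof (rule ldet_only_id)
  fix \<sigma> assume s: "\<sigma> permutes {..<N}" "\<sigma> \<noteq> id"
  then obtain i where "i < N" "i < \<sigma> i"
    using permutes_natset_le[OF s(1)] by (meson lessThan_iff not_le)
  moreover have "\<sigma> i < N" using s(1) \<open>i < N\<close> permutes_in_image[of \<sigma> "{..<N}" i] by simp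
  ultimately show "\<exists>i<N. M i (\<sigma> i) = 0" using assms by blast
qed

lemma ldet_upper_triangular:
  assumes "\<And>i r. r < i \<Longrightarrow> i < N \<Longrightarrow> M i r = 0"
  shows "ldet N M = (\<Prod>i<N. M i i)"
proof (rule ldet_only_id)
  fix \<sigma> assume s: "\<sigma> permutes {..<N}" "\<sigma> \<noteq> id"
  then obtain i where "i < N" "\<sigma> i < i"
    using permutes_natset_ge[OF s(1)] by (meson lessThan_iff not_le)
  then show "\<exists>i<N. M i (\<sigma> i) = 0" using assms by blast
qed

text \<open>Only permutations fixing the last index survive.\<close>

lemma ldet_Suc_last_row:
  assumes "\<And>j. j < n \<Longrightarrow> M n j = 0" "M n n = 1"
  shows "ldet (Suc n) M = ldet n M"
proof -
  have "ldet (Suc n) M = (\<Sum>\<sigma>\<in>{\<sigma>. \<sigma> permutes {..<n}}. of_int (sign \<sigma>) * (\<Prod>i<Suc n. M i (\<sigma> i)))"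
    unfolding ldet_def
  proof (rule sum.mono_neutral_right)
    show "{\<sigma>. \<sigma> permutes {..<n}} \<subseteq> {\<sigma>. \<sigma> permutes {..<Suc n}}"
      using permutes_subset[of _ "{..<n}" "{..<Suc n}"] by auto
    show "\<forall>\<sigma>\<in>{\<sigma>. \<sigma> permutes {..<Suc n}} - {\<sigma>. \<sigma> permutes {..<n}}.
        of_int (sign \<sigma>) * (\<Prod>i<Suc n. M i (\<sigma> i)) = 0"
    proof
      fix \<sigma> assume s: "\<sigma> \<in> {\<sigma>. \<sigma> permutes {..<Suc n}} - {\<sigma>. \<sigma> permutes {..<n}}"
      have "\<sigma> n \<noteq> n"
      proof
        assume "\<sigma> n = n"
        then have "\<sigma> permutes {..<n}"
          using s by (auto simp: less_Suc_eq intro: permutes_superset[of \<sigma> "{..<Suc n}" "{..<n}"])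
        then show False using s by simp
      qed
      moreover have "\<sigma> n < Suc n"
        using s permutes_in_image[of \<sigma> "{..<Suc n}" n] by simp
      ultimately have "M n (\<sigma> n) = 0" using assms(1) by simp
      then show "of_int (sign \<sigma>) * (\<Prod>i<Suc n. M i (\<sigma> i)) = 0" by simp
    qed
  qed (auto simp: finite_permutations)
  also have "\<dots> = ldet n M"
    unfolding ldet_def
  proof (rule sum.cong[OF refl])
    fix \<sigma> assume "\<sigma> \<in> {\<sigma>. \<sigma> permutes {..<n}}"
    then have "\<sigma> n = n" using permutes_not_in[of \<sigma> "{..<n}" n] by simp
    then show "of_int (sign \<sigma>) * (\<Prod>i<Suc n. M i (\<sigma> i)) = of_int (sign \<sigma>) * (\<Prod>i<n. M i (\<sigma> i))"
      using assms(2) by simp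
  qed
  finally show ?thesis .
qed

section \<open>Evaluation of the factorial Schur functions\<close>

text \<open>The determinant does not depend on its size: an added row of length 0 has entries of
  negative index left of the diagonal and h_0 = 1 on it.\<close>

lemma fschur_eq_ldet:
  assumes "length mu \<le> N"
  shows "fschur mu a = ldet N (\<lambda>i j. hfac (beta mu i + int j) (shiftseq (- int j) a))"
  using assms
proof (induction N rule: dec_induct)
  case base
  show ?case by (simp add: fschur_def beta_def algebra_simps)
next
  case (step N)
  then have "part mu (Suc N) = 0" by (simp add: part_def)
  then have "ldet (Suc N) (\<lambda>i j. hfac (beta mu i + int j) (shiftseq (- int j) a)) =
      ldet N (\<lambda>i j. hfac (beta mu i + int j) (shiftseq (- int j) a))"
    by (intro ldet_Suc_last_row) (simp_all add: beta_def hfac_def)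
  then show ?case using step.IH by simp
qed

lemma psize_eq_sum_part:
  assumes "length mu \<le> N"
  shows "psize mu = (\<Sum>i<N. part mu (Suc i))"
proof -
  have "psize mu = (\<Sum>i<length mu. part mu (Suc i))"
    by (simp add: psize_def sum_list_sum_nth lessThan_atLeast0 part_def)
  also have "\<dots> = (\<Sum>i<N. part mu (Suc i))"
    by (rule sum.mono_neutral_left) (use assms in \<open>auto simp: part_def\<close>)
  finally show ?thesis .
qed

lemma partition_eqI:
  assumes "is_partition lam" "is_partition mu"
    and "length lam \<le> N" "length mu \<le> N" and eq: "\<And>i. i < N \<Longrightarrow> part lam (Suc i) = part mu (Suc i)"
  shows "lam = mu"
proof -
  have pos: "i < length nu \<longleftrightarrow> part nu (Suc i) > 0" if "is_partition nu" for nu i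
    using that by (auto simp: part_def is_partition_def in_set_conv_nth intro!: gr0I)
  have len: "length lam = length mu"
    using assms by (metis pos linorder_neqE_nat order_less_le_trans order_less_irrefl)
  show ?thesis
  proof (rule nth_equalityI[OF len])
    fix i assume "i < length lam"
    then show "lam ! i = mu ! i" using eq[of i] len assms(3) by (simp add: part_def)
  qed
qed

text \<open>The beta numbers sum to the size minus a constant, so domination together with the size
  bound forces equality in every row. Both sequences decrease strictly, hence the permutation is
  increasing and so the identity.\<close>

lemma permuted_beta_dominates_imp_eq:
  assumes lam: "is_partition lam" "length lam \<le> N" and mu: "is_partition mu" "length mu \<le> N"
    and size: "psize lam \<le> psize mu"
    and s: "\<sigma> permutes {..<N}" and dom: "\<And>i. i < N \<Longrightarrow> beta mu i \<le> beta lam (\<sigma> i)"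
  shows "lam = mu"
proof -
  have sum_beta: "(\<Sum>i<N. beta nu i) = int (psize nu) - (\<Sum>i<N. int i)" if "length nu \<le> N" for nu
    using psize_eq_sum_part[OF that] by (simp add: beta_def sum_subtractf)
  have perm: "(\<Sum>i<N. beta lam (\<sigma> i)) = (\<Sum>i<N. beta lam i)"
    using sum.permute[OF s, of "beta lam"] by (simp add: comp_def)
  have "(\<Sum>i<N. beta mu i) \<le> (\<Sum>i<N. beta lam (\<sigma> i))"
    by (rule sum_mono) (use dom in auto)
  then have "(\<Sum>i<N. beta mu i) = (\<Sum>i<N. beta lam (\<sigma> i))"
    using size unfolding perm sum_beta[OF lam(2)] sum_beta[OF mu(2)] by linarith
  then have eq: "i < N \<Longrightarrow> beta mu i = beta lam (\<sigma> i)" for i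
    by (rule sum_mono_inv) (use dom in auto)
  have mono: "\<sigma> i < \<sigma> j" if "i < j" "j < N" for i j
  proof (rule ccontr)
    assume "\<not> \<sigma> i < \<sigma> j"
    moreover have "beta lam (\<sigma> j) < beta lam (\<sigma> i)"
      using eq[of i] eq[of j] beta_strict_antimono[OF mu(1) that(1)] that by simp
    ultimately show False
      using beta_strict_antimono[OF lam(1), of "\<sigma> j" "\<sigma> i"] by (cases "\<sigma> i = \<sigma> j") auto
  qed
  have "i \<le> \<sigma> i" if "i < N" for i
    using that
  proof (induction i)
    case (Suc i)
    then show ?case using mono[of i "Suc i"] by simp
  qed simp
  then have "\<sigma> = id"
    by (intro permutes_natset_ge[OF s]) auto
  then show ?thesis
    using eq by (intro partition_eqI[OF lam(1) mu(1) lam(2) mu(2)]) (simp add: beta_def)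
qed

locale schur_evaluation =
  fixes a :: "int \<Rightarrow> complex" and lam mu :: "nat list" and N :: nat
  assumes inj_a: "inj a" and lam: "is_partition lam" "length lam \<le> N"
    and mu: "is_partition mu" "length mu \<le> N" and N_pos: "N > 0"
begin

definition x :: "nat \<Rightarrow> complex" where
  "x i = a (beta lam i)"

definition D :: "nat \<Rightarrow> complex" where
  "D r = (\<Prod>s\<in>{..<N} - {r}. x r - x s)"

text \<open>The row factor of the entries; the Lagrange denominators are put here so that
  \<open>V\<close> has only products.\<close>

definition A :: "nat \<Rightarrow> nat \<Rightarrow> complex" where
  "A i r = (\<Prod>l\<in>{1 - int N..beta mu i - 1}. x r - a l) / D r"

definition V :: "nat \<Rightarrow> nat \<Rightarrow> complex" where
  "V r j = (\<Prod>l\<in>{1 - int j..0}. x r - a l)"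

text \<open>\<open>A\<close> with its interval of labels replaced by the nodes of the later rows. It
  is triangular and inverts the determinant of \<open>V\<close>.\<close>

definition U :: "nat \<Rightarrow> nat \<Rightarrow> complex" where
  "U i r = (\<Prod>s\<in>{i<..<N}. x r - x s) / D r"

lemma inj_x: "inj_on x {..<N}"
  using inj_a inj_beta[OF lam(1)] by (auto simp: inj_def inj_on_def x_def)

lemma eval_fschur: "eval_at (fschur mu a) lam a = ldet N A * ldet N V"
proof -
  have "eval_at (fschur mu a) lam a =
      ldet N (\<lambda>i j. seval (hfac (beta mu i + int j) (shiftseq (- int j) a)) (xpt lam a) (ypt lam a))"
    by (simp add: eval_at_def fschur_eq_ldet[OF mu(2)] seval_ldet)
  also have "\<dots> = ldet N (\<lambda>i j. \<Sum>r<N. A i r * V r j)"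
    unfolding ldet_def
  proof (intro sum.cong refl arg_cong[where f = "\<lambda>u. _ * u"] prod.cong)
    fix \<sigma> i assume s: "\<sigma> \<in> {\<sigma>. \<sigma> permutes {..<N}}" and "i \<in> {..<N}"
    then have i: "i < N" and j: "\<sigma> i < N" using permutes_in_image[of \<sigma> "{..<N}" i] by auto
    \<comment> \<open>Row lengths are nonnegative and i < N, so \<open>beta mu i\<close> is at least
      1 - N.\<close>
    have "int (\<sigma> i) + 1 - int N \<le> beta mu i + int (\<sigma> i)"
      using i by (simp add: beta_def)
    from seval_hfac[OF inj_a lam j this]
    show "seval (hfac (beta mu i + int (\<sigma> i)) (shiftseq (- int (\<sigma> i)) a)) (xpt lam a) (ypt lam a) =
        (\<Sum>r<N. A i r * V r (\<sigma> i))"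
      by (simp add: divdiff_mult A_def V_def D_def x_def poly_prod)
  qed
  finally show ?thesis by (simp add: ldet_mult)
qed

lemma ldet_U: "ldet N U = (\<Prod>i<N. U i i)"
proof (rule ldet_lower_triangular)
  fix i r assume "i < r" "r < N"
  then have "(\<Prod>s\<in>{i<..<N}. x r - x s) = 0" by (intro prod_zero) auto
  then show "U i r = 0" by (simp add: U_def)
qed

text \<open>Multiplying by \<^term>\<open>U\<close> replaces a Vandermonde computation: the divided differences in the
  product have degree too small to be nonzero below the diagonal.\<close>

lemma ldet_U_mult_ldet_V: "ldet N U * ldet N V = 1"
proof -
  define p q where "p i = (\<Prod>s\<in>{i<..<N}. [:- x s, 1:])" and "q j = (\<Prod>l\<in>{1 - int j..0}. [:- a l, 1:])"
    for i j :: nat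
  have UV: "(\<Sum>r<N. U i r * V r j) = divdiff N x (p i * q j)" for i j
    by (simp add: divdiff_mult p_def q_def U_def V_def D_def poly_prod)
  have deg: "degree (p i * q j) = N - Suc i + j" for i j
  proof -
    have "degree (p i * q j) = degree (p i) + degree (q j)"
      unfolding p_def q_def by (rule degree_mult_eq) auto
    then show ?thesis by (simp add: p_def q_def degree_prod_linear)
  qed
  have lead: "coeff (p i * q j) (N - Suc i + j) = 1" for i j
    using lead_coeff_mult[of "p i" "q j"] unfolding deg by (simp add: p_def q_def lead_coeff_prod)
  have "ldet N U * ldet N V = ldet N (\<lambda>i j. divdiff N x (p i * q j))"
    by (simp add: ldet_mult UV)
  also have "\<dots> = (\<Prod>i<N. divdiff N x (p i * q i))"
  proof (rule ldet_upper_triangular)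
    fix i j assume "j < i" "i < N"
    then show "divdiff N x (p i * q j) = 0"
      using deg[of i j] by (subst divdiff_low_degree[OF inj_x]) (auto intro!: coeff_eq_0)
  qed
  also have "\<dots> = 1"
  proof (rule prod.neutral, rule ballI)
    fix i assume "i \<in> {..<N}"
    \<comment> \<open>On the diagonal the degree is exactly N - 1, so the divided difference is the
      leading coefficient.\<close>
    then have "N - Suc i + i = N - 1" by auto
    then show "divdiff N x (p i * q i) = 1"
      using deg[of i i] lead[of i i] N_pos by (subst divdiff_low_degree[OF inj_x]) auto
  qed
  finally show ?thesis .
qed

text \<open>The node x_r is \<open>a (beta lam r)\<close>, and that index lies in the interval
  because it is at least 1 - N.\<close>

lemma A_eq_0:
  assumes "r < N" "beta lam r < beta mu i"
  shows "A i r = 0"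
proof -
  have "(\<Prod>l\<in>{1 - int N..beta mu i - 1}. x r - a l) = 0"
    by (rule prod_zero) (use assms in \<open>auto simp: x_def intro!: bexI[of _ "beta lam r"] simp: beta_def\<close>)
  then show ?thesis by (simp add: A_def)
qed

end

text \<open>A permutation avoiding all zeros of \<open>A\<close> would make the beta numbers of
  \<open>lam\<close> dominate those of \<open>mu\<close>, forcing the partitions to be
  equal.\<close>

lemma eval_fschur_vanish:
  assumes a: "inj a" and lam: "is_partition lam" and mu: "is_partition mu"
    and size: "psize lam \<le> psize mu" and ne: "lam \<noteq> mu"
  shows "eval_at (fschur mu a) lam a = 0"
proof -
  \<comment> \<open>The successor keeps N positive when both partitions are empty.\<close>
  define N where "N = Suc (max (length lam) (length mu))"
  interpret schur_evaluation a lam mu N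
    using assms by unfold_locales (auto simp: N_def)
  have "ldet N A = 0"
  proof (rule ldet_eq_0I)
    fix \<sigma> assume s: "\<sigma> permutes {..<N}"
    have "\<exists>i<N. beta lam (\<sigma> i) < beta mu i"
      using permuted_beta_dominates_imp_eq[OF lam mu size s] ne by (meson not_le)
    moreover have "i < N \<Longrightarrow> \<sigma> i < N" for i
      using s permutes_in_image[of \<sigma> "{..<N}" i] by simp
    ultimately show "\<exists>i<N. A i (\<sigma> i) = 0"
      using A_eq_0 by blast
  qed
  then show ?thesis by (simp add: eval_fschur)
qed

text \<open>For equal partitions \<open>A\<close> is triangular. Its diagonal entries are those of
  \<open>U\<close> times the factors of the boxes in the row, and \<open>U\<close> cancels against
  \<open>V\<close>.\<close>

lemma eval_fschur_diagonal:
  assumes a: "inj a" and mu: "is_partition mu"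
  shows "eval_at (fschur mu a) mu a =
    (\<Prod>(i, j)\<in>{(i, j). 1 \<le> i \<and> i \<le> length mu \<and> 1 \<le> j \<and> j \<le> part mu i}.
       a (int (part mu i) - int i + 1) - a (int j - int (conjpart mu j)))"
proof -
  define N where "N = Suc (length mu)"
  interpret schur_evaluation a mu mu N
    using assms by unfold_locales (auto simp: N_def)
  define R where "R i = (\<Prod>j\<in>{1..part mu (Suc i)}. x i - a (int j - int (conjpart mu j)))" for i
  have A_diag: "A i i = U i i * R i" if i: "i < N" for i
  proof -
    \<comment> \<open>At the end of row i + 1 the interval ends at \<open>beta mu i - 1\<close>: its
      vertical labels give the later nodes, its horizontal labels the columns of the row.\<close>
    have "part mu (Suc (Suc i)) \<le> part mu (Suc i)"
      by (rule part_antimono[OF mu(1)]) auto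
    from prod_boundary_labels[OF mu _ this, of "\<lambda>l. x i - a l"]
    have "(\<Prod>l\<in>{1 - int N..beta mu i - 1}. x i - a l) = (\<Prod>s\<in>{i<..<N}. x i - x s) * R i"
      using i by (simp add: N_def R_def x_def beta_def algebra_simps atLeastSucLessThan_greaterThanLessThan)
    then show ?thesis by (simp add: A_def U_def)
  qed
  have "ldet N A = (\<Prod>i<N. A i i)"
    by (rule ldet_lower_triangular) (auto intro!: A_eq_0 beta_strict_antimono[OF mu(1)])
  also have "\<dots> = ldet N U * (\<Prod>i<N. R i)"
    by (simp add: A_diag ldet_U prod.distrib)
  finally have "eval_at (fschur mu a) mu a = (\<Prod>i<N. R i) * (ldet N U * ldet N V)"
    by (simp add: eval_fschur mult_ac)
  also have "\<dots> = (\<Prod>i<N. R i)"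
    by (simp add: ldet_U_mult_ldet_V)
  also have "\<dots> = (\<Prod>i<length mu. R i)"
    by (simp add: N_def) (simp add: R_def part_def)
  also have "\<dots> = (\<Prod>i\<in>{1..length mu}. \<Prod>j\<in>{1..part mu i}.
       a (int (part mu i) - int i + 1) - a (int j - int (conjpart mu j)))"
    by (rule prod.reindex_bij_witness[where j = Suc and i = "\<lambda>i. i - 1"])
      (auto simp: R_def x_def beta_def of_nat_diff)
  also have "\<dots> = (\<Prod>(i, j)\<in>Sigma {1..length mu} (\<lambda>i. {1..part mu i}).
       a (int (part mu i) - int i + 1) - a (int j - int (conjpart mu j)))"
    by (rule prod.Sigma) auto
  also have "Sigma {1..length mu} (\<lambda>i. {1..part mu i}) =
      {(i, j). 1 \<le> i \<and> i \<le> length mu \<and> 1 \<le> j \<and> j \<le> part mu i}"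
    by auto
  finally show ?thesis .
qed

text \<open>The two indices at a box differ by its hook length, which is positive, and
  \<open>a\<close> is injective.\<close>

lemma eval_fschur_diagonal_nonzero:
  assumes a: "inj a" and mu: "is_partition mu"
  shows "eval_at (fschur mu a) mu a \<noteq> 0"
proof -
  let ?S = "{(i, j). 1 \<le> i \<and> i \<le> length mu \<and> 1 \<le> j \<and> j \<le> part mu i}"
  have "?S \<subseteq> Sigma {1..length mu} (\<lambda>i. {1..part mu i})" by auto
  then have fin: "finite ?S" by (rule finite_subset) auto
  have "a (int (part mu i) - int i + 1) \<noteq> a (int j - int (conjpart mu j))" if "(i, j) \<in> ?S" for i j
    using that le_conjpart_iff[OF mu, of i j] injD[OF a, of "int (part mu i) - int i + 1" "int j - int (conjpart mu j)"]
    by auto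
  then show ?thesis
    unfolding eval_fschur_diagonal[OF assms] using fin by (auto simp: prod_zero_iff)
qed

section \<open>Degrees and top components\<close>

definition deg_less :: "nat \<Rightarrow> symfun \<Rightarrow> bool" where
  "deg_less n F \<longleftrightarrow> (\<forall>m\<in>Poly_Mapping.keys F. mweight m < n)"

definition homog :: "nat \<Rightarrow> symfun \<Rightarrow> bool" where
  "homog n F \<longleftrightarrow> (\<forall>m\<in>Poly_Mapping.keys F. mweight m = n)"

text \<open>Unlike \<open>top_comp\<close>, this allows \<open>G\<close> to be 0 and hence is stable
  under sums with cancellation; that Schur functions are nonzero is known only later.\<close>

definition is_top :: "nat \<Rightarrow> symfun \<Rightarrow> symfun \<Rightarrow> bool" where
  "is_top n F G \<longleftrightarrow> homog n G \<and> deg_less n (F - G)"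

lemma deg_less_0 [simp]: "deg_less n 0"
  by (simp add: deg_less_def)

lemma deg_less_add: "deg_less n F \<Longrightarrow> deg_less n G \<Longrightarrow> deg_less n (F + G)"
  using Poly_Mapping.keys_add[of F G] by (auto simp: deg_less_def)

lemma deg_less_diff: "deg_less n F \<Longrightarrow> deg_less n G \<Longrightarrow> deg_less n (F - G)"
  using keys_diff[of F G] by (auto simp: deg_less_def)

lemma deg_less_mono: "deg_less n F \<Longrightarrow> n \<le> n' \<Longrightarrow> deg_less n' F"
  by (auto simp: deg_less_def)

lemma deg_less_sum: "(\<And>i. i \<in> A \<Longrightarrow> deg_less n (f i)) \<Longrightarrow> deg_less n (sum f A)"
  by (induction A rule: infinite_finite_induct) (auto intro: deg_less_add)

lemma deg_less_mult:
  assumes "deg_less n F" "deg_less (Suc k) G"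
  shows "deg_less (n + k) (F * G)"
  unfolding deg_less_def
proof
  fix m assume "m \<in> Poly_Mapping.keys (F * G)"
  then obtain m1 m2 where "m = m1 + m2" "m1 \<in> Poly_Mapping.keys F" "m2 \<in> Poly_Mapping.keys G"
    using keys_mult[of F G] by auto
  then show "mweight m < n + k" using assms by (fastforce simp: deg_less_def)
qed

lemma homog_imp_deg_less: "homog n F \<Longrightarrow> deg_less (Suc n) F"
  by (auto simp: homog_def deg_less_def)

lemma homog_0 [simp]: "homog n 0"
  by (simp add: homog_def)

lemma homog_1 [simp]: "homog 0 1"
  by (simp add: homog_def)

lemma homog_lconst: "homog 0 (lconst c)"
  by (auto simp: homog_def lconst_def)

lemma homog_of_int: "homog 0 (of_int z)"
  unfolding single_of_int[symmetric] by (auto simp: homog_def simp del: single_of_int)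

lemma homog_add: "homog n F \<Longrightarrow> homog n G \<Longrightarrow> homog n (F + G)"
  using Poly_Mapping.keys_add[of F G] by (auto simp: homog_def)

lemma homog_sum: "(\<And>i. i \<in> A \<Longrightarrow> homog n (f i)) \<Longrightarrow> homog n (sum f A)"
  by (induction A rule: infinite_finite_induct) (auto intro: homog_add)

lemma homog_mult:
  assumes "homog n F" "homog k G"
  shows "homog (n + k) (F * G)"
  unfolding homog_def
proof
  fix m assume "m \<in> Poly_Mapping.keys (F * G)"
  then obtain m1 m2 where "m = m1 + m2" "m1 \<in> Poly_Mapping.keys F" "m2 \<in> Poly_Mapping.keys G"
    using keys_mult[of F G] by auto
  then show "mweight m = n + k" using assms by (auto simp: homog_def)
qed

lemma homog_hcomp: "homog k (hcomp k)"
  unfolding hcomp_def by (rule homog_sum) (auto simp: homog_def)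

lemma is_top_self: "homog n F \<Longrightarrow> is_top n F F"
  by (simp add: is_top_def)

lemma is_top_imp_deg_less:
  assumes "is_top n F G"
  shows "deg_less (Suc n) F"
proof -
  have "deg_less (Suc n) ((F - G) + G)"
    using assms by (intro deg_less_add) (auto simp: is_top_def intro: deg_less_mono homog_imp_deg_less)
  then show ?thesis by simp
qed

lemma is_top_lookup:
  assumes "is_top n F G" "mweight m = n"
  shows "Poly_Mapping.lookup F m = Poly_Mapping.lookup G m"
proof -
  have "m \<notin> Poly_Mapping.keys (F - G)" using assms by (auto simp: is_top_def deg_less_def)
  then show ?thesis by (simp add: in_keys_iff lookup_minus)
qed

text \<open>Telescoping: FF' - GG' = (F - G)F' + (F' - G')G, with a factor of too small a degree in
  each term.\<close>

lemma is_top_mult: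
  assumes "is_top n F G" "is_top n' F' G'"
  shows "is_top (n + n') (F * F') (G * G')"
proof -
  have "deg_less (n + n') ((F - G) * F')"
    using assms is_top_imp_deg_less[OF assms(2)] by (intro deg_less_mult) (auto simp: is_top_def)
  moreover have "deg_less (n' + n) ((F' - G') * G)"
    using assms by (intro deg_less_mult) (auto simp: is_top_def intro: homog_imp_deg_less)
  ultimately have "deg_less (n + n') ((F - G) * F' + (F' - G') * G)"
    by (intro deg_less_add) (simp_all add: add.commute)
  moreover have "(F - G) * F' + (F' - G') * G = F * F' - G * G'"
    by (simp add: algebra_simps)
  ultimately show ?thesis
    using assms by (simp add: is_top_def homog_mult)
qed

lemma is_top_prod:
  assumes "finite A" "\<And>i. i \<in> A \<Longrightarrow> is_top (n i) (f i) (g i)"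
  shows "is_top (sum n A) (prod f A) (prod g A)"
  using assms by (induction A rule: finite_induct) (auto intro: is_top_mult is_top_self)

lemma is_top_sum:
  assumes "\<And>i. i \<in> A \<Longrightarrow> is_top n (f i) (g i)"
  shows "is_top n (sum f A) (sum g A)"
  using assms unfolding is_top_def sum_subtractf[symmetric] by (auto intro: homog_sum deg_less_sum)

text \<open>The term i = k has coefficient e_0 = 1; all others have smaller degree.\<close>

lemma is_top_hfac: "is_top k (hfac (int k) b) (hcomp k)"
proof (cases k)
  case 0
  then show ?thesis by (simp add: hfac_def hcomp_0 is_top_self)
next
  case (Suc n)
  let ?f = "\<lambda>i. lconst ((-1) ^ (k - i) * esym (k - i) {1..n} (\<lambda>l. b (int l))) * hcomp i"
  have "{S. S \<subseteq> {1..n} \<and> card S = 0} = {{}}"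
    using finite_subset[of _ "{1..n}"] by auto
  then have "esym 0 {1..n} (\<lambda>l. b (int l)) = 1"
    by (simp add: esym_def)
  then have "?f k = hcomp k"
    by (simp add: lconst_def)
  moreover have "hfac (int k) b = (\<Sum>i\<in>{1..k}. ?f i)"
    unfolding hfac_def nat_int using Suc by simp
  moreover have "(\<Sum>i\<in>{1..k}. ?f i) = (\<Sum>i\<in>{1..n}. ?f i) + ?f k"
    using Suc by simp
  ultimately have "hfac (int k) b = (\<Sum>i\<in>{1..n}. ?f i) + hcomp k"
    by simp
  moreover have "deg_less k (?f i)" if "i \<in> {1..n}" for i
  proof (rule deg_less_mono)
    show "deg_less (Suc 0 + i) (?f i)"
      by (intro deg_less_mult homog_imp_deg_less homog_lconst homog_hcomp)
    show "Suc 0 + i \<le> k" using that Suc by auto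
  qed
  then have "deg_less k (\<Sum>i\<in>{1..n}. ?f i)"
    by (rule deg_less_sum)
  ultimately show ?thesis
    by (simp add: is_top_def homog_hcomp)
qed

lemma is_top_fschur: "is_top (psize mu) (fschur mu a) (schur mu)"
  unfolding fschur_def schur_def ldet_def Let_def
proof (rule is_top_sum)
  let ?N = "length mu"
  fix \<sigma> assume "\<sigma> \<in> {\<sigma>. \<sigma> permutes {..<?N}}"
  then have s: "\<sigma> permutes {..<?N}" by simp
  define k where "k i = int (part mu (i + 1)) - int (i + 1) + int (\<sigma> i + 1)" for i
  let ?F = "\<lambda>i. hfac (k i) (shiftseq (1 - int (\<sigma> i + 1)) a)"
  let ?G = "\<lambda>i. if k i < 0 then 0 else hcomp (nat (k i))"
  have "is_top (psize mu) (\<Prod>i<?N. ?F i) (\<Prod>i<?N. ?G i)"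
  \<comment> \<open>A negative index kills the term in both determinants; otherwise the indices sum
    to the size, as a permutation preserves the column sum.\<close>
  proof (cases "\<exists>i<?N. k i < 0")
    case True
    then obtain i where i: "i < ?N" "k i < 0" by auto
    then have "(\<Prod>i<?N. ?F i) = 0" "(\<Prod>i<?N. ?G i) = 0"
      by (auto intro!: prod_zero bexI[of _ i] simp: hfac_def)
    then show ?thesis by (simp only: is_top_self homog_0)
  next
    case False
    have "(\<Sum>i<?N. int (\<sigma> i)) = (\<Sum>i<?N. int i)"
      using sum.permute[OF s, of int] by (simp add: comp_def)
    then have "(\<Sum>i<?N. k i) = int (psize mu)"
      using psize_eq_sum_part[of mu ?N] by (simp add: k_def sum.distrib sum_subtractf)
    moreover have "int (\<Sum>i<?N. nat (k i)) = (\<Sum>i<?N. k i)"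
      unfolding of_nat_sum by (rule sum.cong) (use False in auto)
    ultimately have size: "psize mu = (\<Sum>i<?N. nat (k i))" by linarith
    show ?thesis
      unfolding size
    proof (rule is_top_prod)
      fix i assume "i \<in> {..<?N}"
      then have "k i \<ge> 0" using False by auto
      then show "is_top (nat (k i)) (?F i) (?G i)"
        using is_top_hfac[of "nat (k i)"] by simp
    qed simp
  qed
  from is_top_mult[OF is_top_self[OF homog_of_int] this, of "sign \<sigma>"]
  show "is_top (psize mu) (of_int (sign \<sigma>) * (\<Prod>i<?N. hfac (int (part mu (i + 1)) - int (i + 1) + int (\<sigma> i + 1))
        (shiftseq (1 - int (\<sigma> i + 1)) a)))
      (of_int (sign \<sigma>) * (\<Prod>i<?N. if int (part mu (i + 1)) - int (i + 1) + int (\<sigma> i + 1) < 0 then 0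
        else hcomp (nat (int (part mu (i + 1)) - int (i + 1) + int (\<sigma> i + 1)))))"
    by (simp only: k_def add_0)
qed

lemma sdeg_ge: "m \<in> Poly_Mapping.keys F \<Longrightarrow> mweight m \<le> sdeg F"
  unfolding sdeg_def by (rule Max_ge) auto

lemma lookup_top_comp:
  "Poly_Mapping.lookup (top_comp F) m = (if mweight m = sdeg F then Poly_Mapping.lookup F m else 0)"
proof -
  have "Poly_Mapping.lookup (top_comp F) m =
      (\<Sum>m'\<in>Poly_Mapping.keys F. if m' = m then (if mweight m = sdeg F then Poly_Mapping.lookup F m else 0) else 0)"
    unfolding top_comp_def lookup_sum by (rule sum.cong) (auto simp: lookup_single when_def)
  then show ?thesis by (simp add: in_keys_iff)
qed

lemma homog_top_comp: "homog (sdeg F) (top_comp F)"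
  by (auto simp: homog_def in_keys_iff lookup_top_comp split: if_splits)

lemma is_top_nonzero:
  assumes top: "is_top n F G" and "G \<noteq> 0"
  shows "sdeg F = n" "top_comp F = G"
proof -
  obtain m where m: "m \<in> Poly_Mapping.keys G"
    using assms(2) by (metis keys_eq_empty all_not_in_conv)
  then have w: "mweight m = n" using top by (auto simp: is_top_def homog_def)
  then have "m \<in> Poly_Mapping.keys F" using m is_top_lookup[OF top w] by (simp add: in_keys_iff)
  then have "n \<le> sdeg F" using sdeg_ge[of m F] w by simp
  moreover have "sdeg F \<le> n"
    using is_top_imp_deg_less[OF top] by (auto simp: sdeg_def deg_less_def less_Suc_eq_le)
  ultimately show deg: "sdeg F = n" by simp
  show "top_comp F = G"
  proof (rule poly_mapping_eqI)
    fix m'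
    show "Poly_Mapping.lookup (top_comp F) m' = Poly_Mapping.lookup G m'"
    proof (cases "mweight m' = n")
      case True
      then show ?thesis using is_top_lookup[OF top True] by (simp add: lookup_top_comp deg)
    next
      case False
      then have "m' \<notin> Poly_Mapping.keys G" using top by (auto simp: is_top_def homog_def)
      then show ?thesis using False by (simp add: lookup_top_comp deg in_keys_iff)
    qed
  qed
qed

section \<open>Uniqueness\<close>

text \<open>Constants act by multiplication; this provides span, independence and the dimension
  bound.\<close>

interpretation symfun: vector_space "\<lambda>c F. lconst c * F"
proof
  fix c d :: complex and F G :: symfun
  show "lconst c * (F + G) = lconst c * F + lconst c * G" by (rule distrib_left)
  show "lconst (c + d) * F = lconst c * F + lconst d * F"
    by (simp add: lconst_def single_add distrib_right)
  show "lconst c * (lconst d * F) = lconst (c * d) * F"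
    by (simp add: lconst_def mult_single mult.assoc[symmetric])
  show "lconst 1 * F = F" by (simp add: lconst_def)
qed

lemma eval_at_sum_scaled:
  "eval_at (\<Sum>i\<in>A. lconst (c i) * f i) lam a = (\<Sum>i\<in>A. c i * eval_at (f i) lam a)"
  by (simp add: eval_at_def seval_sum)

text \<open>Induction on size: at the point of \<open>mu\<close>, smaller partitions have
  coefficient 0 and all others except \<open>mu\<close> vanish. Assuming only zero values serves
  both independence and the exclusion of \<open>F\<close> from the span.\<close>

lemma fschur_combination_zero:
  assumes a: "inj a" and fin: "finite P" and P: "\<And>mu. mu \<in> P \<Longrightarrow> is_partition mu"
    and zero: "\<And>lam. lam \<in> P \<Longrightarrow> eval_at (\<Sum>mu\<in>P. lconst (c mu) * fschur mu a) lam a = 0"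
    and "mu \<in> P"
  shows "c mu = 0"
  using \<open>mu \<in> P\<close>
proof (induction mu rule: measure_induct_rule[of psize])
  case (less mu)
  have "0 = (\<Sum>nu\<in>P. c nu * eval_at (fschur nu a) mu a)"
    using zero[OF less.prems] by (simp add: eval_at_sum_scaled)
  also have "\<dots> = (\<Sum>nu\<in>{mu}. c nu * eval_at (fschur nu a) mu a)"
  proof (rule sum.mono_neutral_right)
    show "\<forall>nu\<in>P - {mu}. c nu * eval_at (fschur nu a) mu a = 0"
    proof
      fix nu assume nu: "nu \<in> P - {mu}"
      show "c nu * eval_at (fschur nu a) mu a = 0"
      proof (cases "psize nu < psize mu")
        case True
        then show ?thesis using less.IH nu by simp
      next
        case False
        have "eval_at (fschur nu a) mu a = 0"
          by (rule eval_fschur_vanish[OF a P P]) (use nu less.prems False in auto)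
        then show ?thesis by simp
      qed
    qed
  qed (use fin less.prems in auto)
  finally show ?case
    using eval_fschur_diagonal_nonzero[OF a P[OF less.prems]] by simp
qed

text \<open>Evaluate at the partition that is not larger than the other.\<close>

lemma fschur_inj:
  assumes a: "inj a" and mu: "is_partition mu" "is_partition nu" and eq: "fschur mu a = fschur nu a"
  shows "mu = nu"
proof (rule ccontr)
  assume ne: "mu \<noteq> nu"
  show False
  proof (cases "psize mu \<le> psize nu")
    case True
    then show False
      using eval_fschur_vanish[OF a mu True ne] eval_fschur_diagonal_nonzero[OF a mu(1)] eq by simp
  next
    case False
    then show False
      using eval_fschur_vanish[OF a mu(2,1)] eval_fschur_diagonal_nonzero[OF a mu(2)] eq ne by simp
  qed
qed

lemma deg_less_in_span_monomials:
  assumes "deg_less n F"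
  shows "F \<in> symfun.span ((\<lambda>m. Poly_Mapping.single m 1) ` {m. mweight m < n})"
proof -
  have "(\<Sum>m\<in>Poly_Mapping.keys F. lconst (Poly_Mapping.lookup F m) * Poly_Mapping.single m 1)
      \<in> symfun.span ((\<lambda>m. Poly_Mapping.single m 1) ` {m. mweight m < n})"
    using assms by (intro symfun.span_sum symfun.span_scale symfun.span_base) (auto simp: deg_less_def)
  then show ?thesis
    using symfun_sum_monomials[of F] by (simp add: lconst_def mult_single)
qed

text \<open>The triangularity of the evaluations makes the \<^term>\<open>fschur mu a\<close> with \<open>|\<mu>| < n\<close> independent, even
  after adding a nonzero \<^term>\<open>F\<close> that vanishes at all these points; there are as many of them as
  monomials of degree below \<^term>\<open>n\<close>, so there is no room for such an \<^term>\<open>F\<close>.\<close>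

lemma vanishing_imp_zero:
  assumes a: "inj a" and deg: "deg_less n F"
    and zero: "\<And>lam. is_partition lam \<Longrightarrow> psize lam < n \<Longrightarrow> eval_at F lam a = 0"
  shows "F = 0"
proof (rule ccontr)
  assume "F \<noteq> 0"
  define P where "P = {mu. is_partition mu \<and> psize mu < n}"
  define S where "S = (\<lambda>mu. fschur mu a) ` P"
  define T where "T = (\<lambda>m. Poly_Mapping.single m (1::complex)) ` {m. mweight m < n}"
  have finP: "finite P" unfolding P_def by (rule finite_partitions)
  have inj: "inj_on (\<lambda>mu. fschur mu a) P"
    by (rule inj_onI) (auto simp: P_def intro: fschur_inj[OF a])
  have sum_S: "(\<Sum>v\<in>S. lconst (u v) * v) = (\<Sum>mu\<in>P. lconst (u (fschur mu a)) * fschur mu a)" for u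
    unfolding S_def by (simp add: sum.reindex[OF inj])
  have coeffs: "u (fschur mu a) = 0"
    if "mu \<in> P" and "\<And>lam. lam \<in> P \<Longrightarrow> eval_at (\<Sum>v\<in>S. lconst (u v) * v) lam a = 0" for u mu
    by (rule fschur_combination_zero[OF a finP, where c = "\<lambda>mu. u (fschur mu a)"])
      (use that in \<open>auto simp: sum_S P_def\<close>)
  have ind: "symfun.independent S"
  proof (rule symfun.independent_if_scalars_zero)
    show "finite S" using finP by (simp add: S_def)
    fix u v assume "(\<Sum>v\<in>S. lconst (u v) * v) = 0" "v \<in> S"
    then show "u v = 0" using coeffs[of _ u] by (auto simp: S_def eval_at_def)
  qed
  \<comment> \<open>In the span, the zero values of \<open>F\<close> would make all its coefficients
    0.\<close>
  have notin: "F \<notin> symfun.span S"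
  proof
    assume "F \<in> symfun.span S"
    then obtain u where u: "F = (\<Sum>v\<in>S. lconst (u v) * v)"
      using symfun.span_finite[of S] finP by (auto simp: S_def)
    then have "u (fschur mu a) = 0" if "mu \<in> P" for mu
      using coeffs[OF that, of u] zero by (auto simp: P_def)
    then have "F = 0" unfolding u sum_S by (simp add: lconst_def)
    then show False using \<open>F \<noteq> 0\<close> by simp
  qed
  have "insert F S \<subseteq> symfun.span T"
    using deg_less_in_span_monomials[of n] deg deg_less_mono[OF is_top_imp_deg_less[OF is_top_fschur]]
    by (auto simp: S_def T_def P_def Suc_le_eq)
  moreover have "finite T" unfolding T_def by (intro finite_imageI finite_mweight_less)
  ultimately have "card (insert F S) \<le> card T"
    using symfun.independent_span_bound[of T "insert F S"] symfun.independent_insertI[OF notin ind] by simp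
  also have "\<dots> \<le> card {m. mweight m < n}"
    unfolding T_def by (rule card_image_le[OF finite_mweight_less])
  also have "\<dots> \<le> card P"
    unfolding P_def by (rule card_monomials_le_card_partitions)
  also have "\<dots> = card S"
    unfolding S_def by (simp add: card_image inj)
  finally have "card (insert F S) \<le> card S" .
  moreover have "F \<notin> S" using notin symfun.span_base by blast
  moreover have "finite S" using finP by (simp add: S_def)
  ultimately show False by simp
qed

text \<open>Otherwise \<open>fschur mu a\<close> would have degree below the size of
  \<open>mu\<close> while vanishing at all smaller partitions, so it would be 0 against its diagonal
  value.\<close>

lemma schur_nonzero:
  assumes a: "inj (a :: int \<Rightarrow> complex)" and mu: "is_partition mu"
  shows "schur mu \<noteq> 0"
proof
  assume "schur mu = 0"
  then have "deg_less (psize mu) (fschur mu a)"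
    using is_top_fschur[of mu a] by (simp add: is_top_def)
  then have "fschur mu a = 0"
    by (rule vanishing_imp_zero[OF a]) (auto intro!: eval_fschur_vanish[OF a _ mu])
  then show False
    using eval_fschur_diagonal_nonzero[OF a mu] by (simp add: eval_at_def)
qed

theorem theorem13:
  fixes a :: "int \<Rightarrow> complex" and mu :: "nat list" and F :: symfun
  assumes "inj a" and "is_partition mu"
  shows "(F = fschur mu a \<longleftrightarrow>
            (\<forall>lam. is_partition lam \<and> lam \<noteq> mu \<and> psize lam \<le> psize mu \<longrightarrow> eval_at F lam a = 0)
            \<and> sdeg F \<le> psize mu
            \<and> eval_at F mu a =
                (\<Prod>(i, j)\<in>{(i, j). 1 \<le> i \<and> i \<le> length mu \<and> 1 \<le> j \<and> j \<le> part mu i}.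
                   a (int (part mu i) - int i + 1) - a (int j - int (conjpart mu j))))
       \<and> (F = fschur mu a \<longleftrightarrow>
            (\<forall>lam. is_partition lam \<and> psize lam < psize mu \<longrightarrow> eval_at F lam a = 0)
            \<and> top_comp F = schur mu)"
    (is "(_ \<longleftrightarrow> ?van \<and> ?deg \<and> ?val) \<and> (_ \<longleftrightarrow> ?van' \<and> ?top)")
proof -
  let ?s = "fschur mu a"
  note top = is_top_fschur[of mu a]
  note sdeg_s = is_top_nonzero(1)[OF top schur_nonzero[OF assms]]
  note top_s = is_top_nonzero(2)[OF top schur_nonzero[OF assms]]
  \<comment> \<open>The bound stays free: the first characterisation uses the size of
    \<open>mu\<close> plus one, the second the size itself.\<close>
  have eqI: "F = ?s" if "deg_less n (F - ?s)"
    "\<And>lam. is_partition lam \<Longrightarrow> psize lam < n \<Longrightarrow> eval_at F lam a = eval_at ?s lam a" for n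
    using vanishing_imp_zero[OF assms(1) that(1)] that(2) by (simp add: eval_at_def)
  have "F = ?s" if van: ?van and deg: ?deg and val: ?val
  proof (rule eqI)
    have "deg_less (Suc (psize mu)) F"
      using deg sdeg_ge[of _ F] by (fastforce simp: deg_less_def)
    then show "deg_less (Suc (psize mu)) (F - ?s)"
      by (rule deg_less_diff[OF _ is_top_imp_deg_less[OF top]])
    fix lam assume "is_partition lam" "psize lam < Suc (psize mu)"
    then show "eval_at F lam a = eval_at ?s lam a"
      using van val eval_fschur_vanish[OF assms(1) _ assms(2), of lam] eval_fschur_diagonal[OF assms]
      by (cases "lam = mu") auto
  qed
  moreover have "F = ?s" if van: ?van' and F: ?top
  proof (rule eqI)
    \<comment> \<open>A monomial of the nonzero Schur function pins down the degree of
      \<open>F\<close>, which the equality of top components does not state.\<close>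
    obtain m where "m \<in> Poly_Mapping.keys (schur mu)"
      using schur_nonzero[OF assms] by (metis keys_eq_empty all_not_in_conv)
    then have sdeg: "sdeg F = psize mu"
      using top homog_top_comp[of F] F by (auto simp: is_top_def homog_def)
    show "deg_less (psize mu) (F - ?s)"
      unfolding deg_less_def
    proof (rule ballI, rule ccontr)
      fix m assume m: "m \<in> Poly_Mapping.keys (F - ?s)" and "\<not> mweight m < psize mu"
      moreover have "mweight m \<le> psize mu"
        using m keys_diff[of F ?s] sdeg_ge[of m F] sdeg_ge[of m ?s] sdeg sdeg_s by auto
      ultimately have w: "mweight m = psize mu" by simp
      then have "Poly_Mapping.lookup F m = Poly_Mapping.lookup ?s m"
        using is_top_lookup[OF top w] lookup_top_comp[of F m] F sdeg by simp
      then show False using m by (simp add: in_keys_iff lookup_minus)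
    qed
    fix lam assume "is_partition lam" "psize lam < psize mu"
    then show "eval_at F lam a = eval_at ?s lam a"
      using van eval_fschur_vanish[OF assms(1) _ assms(2), of lam] by auto
  qed
  moreover have "?van \<and> ?deg \<and> ?val \<and> ?van' \<and> ?top" if "F = ?s"
  proof -
    have "eval_at ?s lam a = 0" if "is_partition lam" "psize lam < psize mu" for lam
      by (rule eval_fschur_vanish[OF assms(1) _ assms(2)]) (use that in auto)
    then show ?thesis
      unfolding that using sdeg_s top_s eval_fschur_diagonal[OF assms] eval_fschur_vanish[OF assms(1) _ assms(2)]
      by auto
  qed
  ultimately show ?thesis by blast
qed

end
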